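(* Let $B\subset\mathbb{R}^2$ be a non-horizontal flat plate, i.e. a closed line segment of positive length that is not parallel to the $x$-axis. Then there is no nontrivial uniformly subsonic flow around $B$, and there is no nontrivial incompressible flow around $B$ with bounded velocity $\mathbf v$.
   Context: The fluid domain is $\Omega=\mathbb{R}^2\setminus B$. Compressible flow. Fix an isentropic coefficient $\gamma>1$ and a Bernoulli constant $K>0$. The pressure law is $P=\varrho^\gamma$; the enthalpy per mass is $\hat p(\varrho)=\frac{\gamma}{\gamma-1}\varrho^{\gamma-1}$ and the sound speed is $c=\sqrt{\gamma\varrho^{\gamma-1}}$. A (steady, irrotational, inviscid) uniformly subsonic flow around $B$ is given by a stream function $\psi:\Omega\to\mathbb{R}$, velocity $\mathbf v=(v^x,v^y)$ and density $\varrho>0$ on $\Omega$ such that: $\psi$ is infinitely differentiable in $\Omega$ and up to each side of the plate away from its endpoints; $\nabla\psi$ is bounded on $\Omega$; $\varrho\mathbf v=(\psi_y,-\psi_x)$; the Bernoulli relation $\frac12|\mathbf v|^2+\hat p(\varrho)=K$ holds; $\partial_xv^y-\partial_yv^x=0$; the slip condition $\psi=0$ holds on $\partial B$ ($\psi$ extended continuously to $\partial B$); and the Mach number $M=|\mathbf v|/c$ satisfies $M\le 1-\delta$ on $\Omega$ for some constant $\delta>0$. Incompressible flow. An incompressible (irrotational) flow around $B$ is given by a harmonic $\psi:\Omega\to\mathbb{R}$, smooth up to each side of the plate away from its endpoints, with $\psi=0$ on $\partial B$ and velocity $\mathbf v=(\psi_y,-\psi_x)$. Conventions. The velocity has a limit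 $\mathbf v_\infty$ as $|\mathbf x|\to\infty$, and the coordinates are such that $\mathbf v_\infty=(v^x_\infty,0)$ with $v^x_\infty\ge0$. A flow is trivial if $\mathbf v\equiv0$, and nontrivial otherwise. *)

theory Defs
  imports "HOL-Analysis.Analysis"
begin

type_synonym plane = "real \<times> real"

definition pdx :: "(plane \<Rightarrow> real) \<Rightarrow> plane \<Rightarrow> real" where
  "pdx f p = deriv (\<lambda>x. f (x, snd p)) (fst p)"

definition pdy :: "(plane \<Rightarrow> real) \<Rightarrow> plane \<Rightarrow> real" where
  "pdy f p = deriv (\<lambda>y. f (fst p, y)) (snd p)"

(* On an open set the operators pdx and pdy only depend on the values of f there, and
   total differentiability of all the functions below makes mixed partial derivatives
   commute.  So only the ordering "first y, then x" has to be listed. *)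
definition smooth_on :: "plane set \<Rightarrow> (plane \<Rightarrow> real) \<Rightarrow> bool" where
  "smooth_on S f \<longleftrightarrow>
     (\<forall>i j. \<forall>p\<in>S. (pdx ^^ i) ((pdy ^^ j) f) differentiable (at p))"

definition laplacian :: "(plane \<Rightarrow> real) \<Rightarrow> plane \<Rightarrow> real" where
  "laplacian f p = pdx (pdx f) p + pdy (pdy f) p"

(* Twice continuously differentiable solutions of Laplace's equation are automatically
   infinitely differentiable. *)
definition harmonic_on :: "plane set \<Rightarrow> (plane \<Rightarrow> real) \<Rightarrow> bool" where
  "harmonic_on S f \<longleftrightarrow> smooth_on S f \<and> (\<forall>p\<in>S. laplacian f p = 0)"

(* The open half-plane to the left of the line directed from a to b.  The two sides of
   the plate with endpoints a and b are plate_side a b and plate_side b a. *)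
definition plate_side :: "plane \<Rightarrow> plane \<Rightarrow> plane set" where
  "plate_side a b = {p. (p - a) \<bullet> (- snd (b - a), fst (b - a)) > 0}"

(* Infinitely differentiable off the plate and, from each side, up to the plate without
   its endpoints.  One-sided limits at all points of the open segment amount to
   a continuous extension of the derivative to the half-plane together with the open
   segment. *)
definition smooth_up_to_plate :: "plane \<Rightarrow> plane \<Rightarrow> (plane \<Rightarrow> real) \<Rightarrow> bool" where
  "smooth_up_to_plate a b f \<longleftrightarrow>
     smooth_on (- closed_segment a b) f \<and>
     (\<forall>i j. \<forall>p\<in>open_segment a b. \<forall>H\<in>{plate_side a b, plate_side b a}.
        \<exists>l. ((pdx ^^ i) ((pdy ^^ j) f) \<longlongrightarrow> l) (at p within H))"

(* The values of the stream function on the plate itself are irrelevant: its continuous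
   extension from the fluid domain is required to vanish on the boundary. *)
definition slip_condition :: "plane set \<Rightarrow> (plane \<Rightarrow> real) \<Rightarrow> bool" where
  "slip_condition B \<psi> \<longleftrightarrow> (\<forall>p\<in>frontier B. (\<psi> \<longlongrightarrow> 0) (at p within (- B)))"

definition horizontal_at_infinity :: "(plane \<Rightarrow> plane) \<Rightarrow> bool" where
  "horizontal_at_infinity v \<longleftrightarrow> (\<exists>vx\<ge>0. (v \<longlongrightarrow> (vx, 0)) at_infinity)"

definition enthalpy :: "real \<Rightarrow> real \<Rightarrow> real" where
  "enthalpy \<gamma> r = \<gamma> / (\<gamma> - 1) * r powr (\<gamma> - 1)"

definition sound_speed :: "real \<Rightarrow> real \<Rightarrow> real" where
  "sound_speed \<gamma> r = sqrt (\<gamma> * r powr (\<gamma> - 1))"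

definition uniformly_subsonic_flow ::
    "real \<Rightarrow> real \<Rightarrow> plane \<Rightarrow> plane \<Rightarrow> (plane \<Rightarrow> real) \<Rightarrow> (plane \<Rightarrow> plane) \<Rightarrow> (plane \<Rightarrow> real) \<Rightarrow> bool"
  where
  "uniformly_subsonic_flow \<gamma> K a b \<psi> v \<rho> \<longleftrightarrow>
     (let B = closed_segment a b; \<Omega> = - B in
        smooth_up_to_plate a b \<psi> \<and>
        bounded ((\<lambda>p. (pdx \<psi> p, pdy \<psi> p)) ` \<Omega>) \<and>
        (\<forall>p\<in>\<Omega>. \<rho> p > 0) \<and>
        (\<forall>p\<in>\<Omega>. \<rho> p *\<^sub>R v p = (pdy \<psi> p, - pdx \<psi> p)) \<and>
        (\<forall>p\<in>\<Omega>. (norm (v p))\<^sup>2 / 2 + enthalpy \<gamma> (\<rho> p) = K) \<and>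
        (\<forall>p\<in>\<Omega>. v differentiable (at p) \<and>
                 pdx (\<lambda>q. snd (v q)) p - pdy (\<lambda>q. fst (v q)) p = 0) \<and>
        slip_condition B \<psi> \<and>
        (\<exists>\<delta>>0. \<forall>p\<in>\<Omega>. norm (v p) / sound_speed \<gamma> (\<rho> p) \<le> 1 - \<delta>) \<and>
        horizontal_at_infinity v)"

definition incompressible_flow ::
    "plane \<Rightarrow> plane \<Rightarrow> (plane \<Rightarrow> real) \<Rightarrow> (plane \<Rightarrow> plane) \<Rightarrow> bool" where
  "incompressible_flow a b \<psi> v \<longleftrightarrow>
     (let B = closed_segment a b; \<Omega> = - B in
        harmonic_on \<Omega> \<psi> \<and>
        smooth_up_to_plate a b \<psi> \<and>
        slip_condition B \<psi> \<and>
        (\<forall>p\<in>\<Omega>. v p = (pdy \<psi> p, - pdx \<psi> p)) \<and>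
        horizontal_at_infinity v)"

definition nontrivial_flow :: "plane \<Rightarrow> plane \<Rightarrow> (plane \<Rightarrow> plane) \<Rightarrow> bool" where
  "nontrivial_flow a b v \<longleftrightarrow> (\<exists>p\<in>- closed_segment a b. v p \<noteq> 0)"

end

theory Submission
  imports Defs
begin

text \<open>
  Let \<open>n\<close> be normal to the plate and \<open>u = n \<bullet> v\<close>.  Since \<open>v\<close> is curl free, the gradient of \<open>u\<close> is the
  derivative \<open>D\<^sub>n v\<close> of \<open>v\<close> in direction \<open>n\<close>, and \<open>W = D\<^sub>n (\<rho> v)\<close> is divergence free.  By Bernoulli's law
  \<open>W = \<rho> (D\<^sub>n v - (v \<bullet> D\<^sub>n v / c\<^sup>2) v)\<close>, so \<open>u\<close> solves a divergence form equation which is uniformly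
  elliptic because the flow is uniformly subsonic; for incompressible flow \<open>u\<close> is harmonic.
  The slip condition says that \<open>u\<close> vanishes on both sides of the plate, except perhaps at the tips.
  As \<open>u\<close> is bounded, and as the tips and infinity have capacity zero in the plane, a Caccioppoli
  estimate with logarithmic cutoffs gives \<open>u = 0\<close>.  Hence the horizontal velocity at infinity is
  tangential to the plate and therefore 0.  Finally \<open>D\<^sub>n v = 0\<close>, so \<open>v\<close> is constant along the
  normal ray leading from any point away from the plate to infinity.
\<close>

section \<open>Test functions\<close>

text \<open>Regularity shapes the proof. At interior points of the plate \<open>u\<close> is only
  known to tend to 0, and near the tips it is only known to be bounded, so the test function, a
  squared cutoff times \<open>soft \<epsilon> u\<close>, has to vanish near every point of the
  plate. Off the plate \<open>v\<close> is merely differentiable, and nothing is assumed about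
  derivatives of \<open>\<rho>\<close>. The flux \<open>W\<close> is therefore computed from the
  smooth \<open>\<psi>\<close>: its vanishing divergence is an identity between third derivatives of
  \<open>\<psi>\<close>, and for subsonic flow the continuity of \<open>D_n v\<close> is recovered
  by inverting the linear map that takes \<open>D_n v\<close> to \<open>W\<close>. The normal
  velocity is the right unknown because it is single valued whatever the circulation around the
  plate, whereas a velocity potential need not be. The gain comes from the plane: the squared
  gradient of the logarithmic cutoff is of order \<open>1 / N^2\<close> times the inverse square
  distance, whose integral over the ring grows only like \<open>N\<close>. The error is thus of
  order \<open>1 / N\<close>, while on a fixed box the cutoff stays bounded below.\<close>

lemma pos_part_square_deriv:
  "((\<lambda>s::real. (max 0 s)\<^sup>2) has_real_derivative 2 * max 0 s) (at s)"
proof (cases s "0::real" rule: linorder_cases)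
  case less
  then have "eventually (\<lambda>s::real. (max 0 s)\<^sup>2 = 0) (nhds s)"
    by (intro eventually_mono[OF eventually_nhds_in_open[of "{..<0}"]]) auto
  with less show ?thesis
    by (subst DERIV_cong_ev[OF refl _ refl, where g="\<lambda>_. 0"]) auto
next
  case equal
  have "((\<lambda>h::real. (max 0 h)\<^sup>2 / h) \<longlongrightarrow> 0) (at 0)"
  proof (rule Lim_null_comparison)
    show "eventually (\<lambda>h::real. norm ((max 0 h)\<^sup>2 / h) \<le> \<bar>h\<bar>) (at 0)"
      by (intro always_eventually allI) (auto simp: max_def power2_eq_square)
    show "((\<lambda>h::real. \<bar>h\<bar>) \<longlongrightarrow> 0) (at 0)"
      by (intro tendsto_eq_intros) auto
  qed
  with equal show ?thesis by (simp add: DERIV_def)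
next
  case greater
  then have "eventually (\<lambda>s::real. (max 0 s)\<^sup>2 = s\<^sup>2) (nhds s)"
    by (intro eventually_mono[OF eventually_nhds_in_open[of "{0<..}"]]) auto
  with greater show ?thesis
    by (subst DERIV_cong_ev[OF refl _ refl, where g="\<lambda>s. s\<^sup>2"]) (auto intro!: derivative_eq_intros)
qed

text \<open>By Fubini it suffices to integrate along each horizontal line; the ends
  \<open>(R, y)\<close> and \<open>(-R, y)\<close> have norm at least \<open>R\<close>, so
  \<open>P\<close> vanishes there.\<close>

lemma integral_pdx_compact_support:
  fixes P P' :: "real \<times> real \<Rightarrow> real"
  assumes der: "\<And>x y. ((\<lambda>x. P (x, y)) has_real_derivative P' (x, y)) (at x)"
    and cont: "continuous_on UNIV P'"
    and zero: "\<And>p. R \<le> norm p \<Longrightarrow> P p = 0" and "0 < R"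
  shows "integral (cbox (-R, -R) (R, R)) P' = 0"
proof -
  have c: "continuous_on S P'" for S
    using cont continuous_on_subset by blast
  have "integral (cbox (-R, -R) (R, R)) P'
      = integral (cbox (-R) R) (\<lambda>x. integral (cbox (-R) R) (\<lambda>y. P' (x, y)))"
    by (rule integral_prod_continuous[OF c])
  also have "\<dots> = integral (cbox (-R) R) (\<lambda>y. integral (cbox (-R) R) (\<lambda>x. P' (x, y)))"
    by (rule integral_swap_continuous) (simp add: c case_prod_unfold)
  also have "\<dots> = integral (cbox (-R) R) (\<lambda>y. 0)"
  proof (rule Henstock_Kurzweil_Integration.integral_cong)
    fix y
    have "((\<lambda>x. P' (x, y)) has_integral P (R, y) - P (-R, y)) {-R..R}"
      using \<open>0 < R\<close> der
      by (intro fundamental_theorem_of_calculus)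
        (auto simp: has_real_derivative_iff_has_vector_derivative[symmetric]
          intro: has_field_derivative_at_within)
    moreover have "P (R, y) = 0" "P (-R, y) = 0"
      using norm_fst_le[of R y] norm_fst_le[of "-R" y] \<open>0 < R\<close> by (auto intro!: zero)
    ultimately show "integral (cbox (-R) R) (\<lambda>x. P' (x, y)) = 0"
      by (simp add: integral_unique)
  qed
  finally show ?thesis by simp
qed

lemma integral_pdy_compact_support:
  fixes P P' :: "real \<times> real \<Rightarrow> real"
  assumes der: "\<And>x y. ((\<lambda>y. P (x, y)) has_real_derivative P' (x, y)) (at y)"
    and cont: "continuous_on UNIV P'"
    and zero: "\<And>p. R \<le> norm p \<Longrightarrow> P p = 0" and "0 < R"
  shows "integral (cbox (-R, -R) (R, R)) P' = 0"
proof -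
  have c: "continuous_on S P'" for S
    using cont continuous_on_subset by blast
  have "integral (cbox (-R, -R) (R, R)) P'
      = integral (cbox (-R) R) (\<lambda>x. integral (cbox (-R) R) (\<lambda>y. P' (x, y)))"
    by (rule integral_prod_continuous[OF c])
  also have "\<dots> = integral (cbox (-R) R) (\<lambda>x. 0)"
  proof (rule Henstock_Kurzweil_Integration.integral_cong)
    fix x
    have "((\<lambda>y. P' (x, y)) has_integral P (x, R) - P (x, -R)) {-R..R}"
      using \<open>0 < R\<close> der
      by (intro fundamental_theorem_of_calculus)
        (auto simp: has_real_derivative_iff_has_vector_derivative[symmetric]
          intro: has_field_derivative_at_within)
    moreover have "P (x, R) = 0" "P (x, -R) = 0"
      using norm_snd_le[of R x] norm_snd_le[of "-R" x] \<open>0 < R\<close> by (auto intro!: zero)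
    ultimately show "integral (cbox (-R) R) (\<lambda>y. P' (x, y)) = 0"
      by (simp add: integral_unique)
  qed
  finally show ?thesis by simp
qed

section \<open>Gradients and partial derivatives\<close>

lemma GDERIV_pdx:
  fixes f :: "plane \<Rightarrow> real"
  assumes "GDERIV f (x, y) :> D"
  shows "((\<lambda>x. f (x, y)) has_real_derivative fst D) (at x)"
proof -
  have "((\<lambda>x. (x, y)) has_derivative (\<lambda>h. (h, 0))) (at x)"
    by (auto intro!: derivative_eq_intros)
  from diff_chain_at[OF this assms[unfolded gderiv_def]]
  show ?thesis
    unfolding has_field_derivative_def
    by (simp add: o_def inner_prod_def mult_commute_abs)
qed

lemma GDERIV_pdy:
  fixes f :: "plane \<Rightarrow> real"
  assumes "GDERIV f (x, y) :> D"
  shows "((\<lambda>y. f (x, y)) has_real_derivative snd D) (at y)"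
proof -
  have "((\<lambda>y. (x, y)) has_derivative (\<lambda>h. (0, h))) (at y)"
    by (auto intro!: derivative_eq_intros)
  from diff_chain_at[OF this assms[unfolded gderiv_def]]
  show ?thesis
    unfolding has_field_derivative_def
    by (simp add: o_def inner_prod_def mult_commute_abs)
qed

text \<open>Serves as uniqueness of the gradient.\<close>

lemma GDERIV_pd:
  fixes f :: "plane \<Rightarrow> real"
  assumes "GDERIV f p :> D"
  shows "D = (pdx f p, pdy f p)"
  using DERIV_imp_deriv[OF GDERIV_pdx[of f "fst p" "snd p" D]]
    DERIV_imp_deriv[OF GDERIV_pdy[of f "fst p" "snd p" D]] assms
  by (simp add: pdx_def pdy_def)

lemma differentiable_GDERIV:
  fixes f :: "plane \<Rightarrow> real"
  assumes "f differentiable (at p)"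
  shows "GDERIV f p :> (pdx f p, pdy f p)"
proof -
  from assms obtain D where D: "(f has_derivative D) (at p)"
    by (auto simp: differentiable_def)
  interpret D: bounded_linear D using D by (rule has_derivative_bounded_linear)
  have "D h = h \<bullet> (D (1, 0), D (0, 1))" for h
    using D.add[of "fst h *\<^sub>R (1, 0)" "snd h *\<^sub>R (0, 1)"]
    unfolding D.scaleR by (simp add: inner_prod_def)
  then have "D = (\<lambda>h. h \<bullet> (D (1, 0), D (0, 1)))" by blast
  with D have "GDERIV f p :> (D (1, 0), D (0, 1))"
    by (simp add: gderiv_def)
  with GDERIV_pd[OF this] show ?thesis by simp
qed

lemma GDERIV_locally_zero:
  assumes "open S" "p \<in> S" "\<And>q. q \<in> S \<Longrightarrow> f q = 0"
  shows "GDERIV f p :> 0"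
  unfolding gderiv_def
  using has_derivative_transform_within_open[of "\<lambda>_. 0" "\<lambda>_. 0" p UNIV S f] assms by simp

text \<open>Weak form of div \<open>W\<close> = 0. The function \<open>d\<close> is the common value
  of the x-derivative of the first component and minus the y-derivative of the second, so the terms
  \<open>G * d\<close> in div(\<open>G W\<close>) cancel and \<open>DG \<bullet> W\<close> remains.
  Since \<open>G\<close> vanishes near \<open>B\<close>, the extension by 0 leaves no boundary
  terms.\<close>

lemma integral_test_function:
  fixes G d :: "plane \<Rightarrow> real" and DG W :: "plane \<Rightarrow> plane"
  assumes B: "closed B"
    and G: "\<And>p. p \<notin> B \<Longrightarrow> GDERIV G p :> DG p" and DG: "continuous_on (- B) DG"
    and W: "continuous_on (- B) W" and d: "continuous_on (- B) d"
    and Wx: "\<And>x y. (x, y) \<notin> B \<Longrightarrow> ((\<lambda>x. fst (W (x, y))) has_real_derivative d (x, y)) (at x)"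
    and Wy: "\<And>x y. (x, y) \<notin> B \<Longrightarrow> ((\<lambda>y. snd (W (x, y))) has_real_derivative - d (x, y)) (at y)"
    and near: "\<And>p. p \<in> B \<Longrightarrow> \<exists>e>0. \<forall>q\<in>ball p e - B. G q = 0"
    and far: "\<And>p. p \<notin> B \<Longrightarrow> R \<le> norm p \<Longrightarrow> G p = 0" and R: "0 < R"
  shows "((\<lambda>p. if p \<in> B then 0 else DG p \<bullet> W p) has_integral 0) (cbox (-R, -R) (R, R))"
proof -
  have op: "open (- B)" using B by (rule open_Compl)
  have near': "\<exists>e>0. \<forall>q\<in>ball p e - B. G q = 0 \<and> DG q = 0" if "p \<in> B" for p
  proof -
    from near[OF that] obtain e where e: "e > 0" "\<forall>q\<in>ball p e - B. G q = 0" by auto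
    have "DG q = 0" if q: "q \<in> ball p e - B" for q
    proof -
      have "open (ball p e - B)" using B by (intro open_Diff) auto
      then have "GDERIV G q :> 0"
        using e q by (intro GDERIV_locally_zero[of "ball p e - B"]) auto
      with GDERIV_pd[OF this] GDERIV_pd[OF G, of q] q show ?thesis by simp
    qed
    with e show ?thesis by blast
  qed
  \<comment> \<open>Serves both integrands below: each is linear in the pair of \<open>G\<close> and
    \<open>DG\<close>, hence vanishes where both do.\<close>
  have cont0: "continuous_on UNIV (\<lambda>p. if p \<in> B then 0 else f p)"
    if f: "continuous_on (- B) f" and z: "\<And>q. q \<notin> B \<Longrightarrow> G q = 0 \<Longrightarrow> DG q = 0 \<Longrightarrow> f q = 0"
    for f :: "plane \<Rightarrow> real"
  proof -
    have "isCont (\<lambda>p. if p \<in> B then 0 else f p) p" for p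
    proof (cases "p \<in> B")
      case False
      have "isCont f p"
        using f op False by (simp add: continuous_on_eq_continuous_at)
      moreover have "eventually (\<lambda>q. q \<in> - B) (nhds p)"
        using op False by (intro eventually_nhds_in_open) auto
      ultimately show ?thesis
        by (subst isCont_cong[where g=f]) (auto elim: eventually_mono)
    next
      case True
      from near'[OF True] obtain e where e: "e > 0" "\<forall>q\<in>ball p e - B. G q = 0 \<and> DG q = 0" by auto
      have "eventually (\<lambda>q. q \<in> ball p e) (nhds p)"
        using e by (intro eventually_nhds_in_open) auto
      then have "eventually (\<lambda>q. (if q \<in> B then 0 else f q) = 0) (nhds p)"
        by (rule eventually_mono) (use e z in auto)
      then show ?thesis
        by (subst isCont_cong[where g="\<lambda>_. 0"]) auto
    qed
    then show ?thesis by (simp add: continuous_at_imp_continuous_on)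
  qed
  have Gc: "continuous_on (- B) G"
    using G by (auto intro!: continuous_at_imp_continuous_on dest!: has_derivative_continuous simp: gderiv_def)
  let ?ind = "\<lambda>f p. if p \<in> B then 0 else (f p :: real)"
  let ?P = "\<lambda>p. G p * fst (W p)" and ?P' = "\<lambda>p. fst (DG p) * fst (W p) + G p * d p"
  let ?Q = "\<lambda>p. G p * snd (W p)" and ?Q' = "\<lambda>p. snd (DG p) * snd (W p) - G p * d p"
  have P': "continuous_on UNIV (?ind ?P')" and Q': "continuous_on UNIV (?ind ?Q')"
    by (rule cont0; auto intro!: continuous_intros DG W d Gc)+
  have derx: "((\<lambda>x. ?ind ?P (x, y)) has_real_derivative ?ind ?P' (x, y)) (at x)" for x y
  proof (cases "(x, y) \<in> B")
    case False
    have *: "((\<lambda>x. ?P (x, y)) has_real_derivative ?P' (x, y)) (at x)"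
      using DERIV_mult[OF GDERIV_pdx[OF G[OF False]] Wx[OF False]] by (simp add: mult.commute)
    have "open ((\<lambda>x. (x, y)) -` (- B))"
      by (intro continuous_open_vimage op) (auto intro!: continuous_intros)
    with * False show ?thesis
      by (subst DERIV_cong_ev[OF refl _ refl, where g="\<lambda>x. ?P (x, y)"])
        (auto intro!: eventually_mono[OF eventually_nhds_in_open[of "(\<lambda>x. (x, y)) -` (- B)" x]])
  next
    case True
    from near'[OF True] obtain e where e: "e > 0" "\<forall>q\<in>ball (x, y) e - B. G q = 0" by auto
    have "open ((\<lambda>x. (x, y)) -` ball (x, y) e)"
      by (intro continuous_open_vimage) (auto intro!: continuous_intros)
    with True show ?thesis
      by (subst DERIV_cong_ev[OF refl _ refl, where g="\<lambda>x. 0"])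
        (use e in \<open>auto intro!: eventually_mono[OF eventually_nhds_in_open[of "(\<lambda>x. (x, y)) -` ball (x, y) e" x]]\<close>)
  qed
  have dery: "((\<lambda>y. ?ind ?Q (x, y)) has_real_derivative ?ind ?Q' (x, y)) (at y)" for x y
  proof (cases "(x, y) \<in> B")
    case False
    have *: "((\<lambda>y. ?Q (x, y)) has_real_derivative ?Q' (x, y)) (at y)"
      using DERIV_mult[OF GDERIV_pdy[OF G[OF False]] Wy[OF False]] by (simp add: mult.commute)
    have "open ((\<lambda>y. (x, y)) -` (- B))"
      by (intro continuous_open_vimage op) (auto intro!: continuous_intros)
    with * False show ?thesis
      by (subst DERIV_cong_ev[OF refl _ refl, where g="\<lambda>y. ?Q (x, y)"])
        (auto intro!: eventually_mono[OF eventually_nhds_in_open[of "(\<lambda>y. (x, y)) -` (- B)" y]])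
  next
    case True
    from near'[OF True] obtain e where e: "e > 0" "\<forall>q\<in>ball (x, y) e - B. G q = 0" by auto
    have "open ((\<lambda>y. (x, y)) -` ball (x, y) e)"
      by (intro continuous_open_vimage) (auto intro!: continuous_intros)
    with True show ?thesis
      by (subst DERIV_cong_ev[OF refl _ refl, where g="\<lambda>y. 0"])
        (use e in \<open>auto intro!: eventually_mono[OF eventually_nhds_in_open[of "(\<lambda>y. (x, y)) -` ball (x, y) e" y]]\<close>)
  qed
  have "integral (cbox (-R, -R) (R, R)) (?ind ?P') = 0"
    by (rule integral_pdx_compact_support[OF derx P' _ R]) (use far in auto)
  moreover have "integral (cbox (-R, -R) (R, R)) (?ind ?Q') = 0"
    by (rule integral_pdy_compact_support[OF dery Q' _ R]) (use far in auto)
  moreover have "?ind ?P' integrable_on cbox (-R, -R) (R, R)" "?ind ?Q' integrable_on cbox (-R, -R) (R, R)"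
    using P' Q' by (auto intro!: integrable_continuous intro: continuous_on_subset)
  ultimately have "((\<lambda>p. ?ind ?P' p + ?ind ?Q' p) has_integral 0 + 0) (cbox (-R, -R) (R, R))"
    by (intro has_integral_add) (simp_all add: has_integral_iff)
  moreover have "(\<lambda>p. ?ind ?P' p + ?ind ?Q' p) = (\<lambda>p. if p \<in> B then 0 else DG p \<bullet> W p)"
    by (auto simp: inner_prod_def)
  ultimately show ?thesis by simp
qed

section \<open>Logarithmic cutoffs\<close>

text \<open>
  Applying \<open>soft \<epsilon>\<close> to a function with boundary value 0 makes it vanish near the interior of
  the plate.  So its product with a cutoff at the tips and at infinity extends by 0 to a test
  function on the whole plane, and nothing needs to be known about derivatives at the plate.
\<close>

definition soft :: "real \<Rightarrow> real \<Rightarrow> real" where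
  "soft \<epsilon> s = (max 0 (s - \<epsilon>))\<^sup>2 - (max 0 (- s - \<epsilon>))\<^sup>2"

text \<open>Its square is the absolute value of \<open>soft\<close> and its double is the derivative
  of \<open>soft\<close>. Hence \<open>soft^2\<close> divided by that derivative is half the cube of
  \<open>excess\<close>, which stays bounded; this is the quotient that Young's inequality
  produces.\<close>

definition excess :: "real \<Rightarrow> real \<Rightarrow> real" where
  "excess \<epsilon> s = max 0 (\<bar>s\<bar> - \<epsilon>)"

lemma soft_deriv:
  assumes "0 < \<epsilon>"
  shows "(soft \<epsilon> has_real_derivative 2 * excess \<epsilon> s) (at s)"
proof -
  have "((\<lambda>s. (max 0 (s - \<epsilon>))\<^sup>2) has_real_derivative 2 * max 0 (s - \<epsilon>) * 1) (at s)"
    by (rule DERIV_chain2[OF pos_part_square_deriv]) (auto intro!: derivative_eq_intros)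
  moreover have "((\<lambda>s. (max 0 (- s - \<epsilon>))\<^sup>2) has_real_derivative 2 * max 0 (- s - \<epsilon>) * (-1)) (at s)"
    by (rule DERIV_chain2[OF pos_part_square_deriv]) (auto intro!: derivative_eq_intros)
  ultimately have "(soft \<epsilon> has_real_derivative 2 * max 0 (s - \<epsilon>) * 1 - 2 * max 0 (- s - \<epsilon>) * (-1)) (at s)"
    unfolding soft_def by (rule DERIV_diff)
  moreover have "2 * max 0 (s - \<epsilon>) * 1 - 2 * max 0 (- s - \<epsilon>) * (-1) = 2 * excess \<epsilon> s"
    using assms by (auto simp: excess_def max_def)
  ultimately show ?thesis by simp
qed

lemma abs_soft:
  assumes "0 < \<epsilon>"
  shows "\<bar>soft \<epsilon> s\<bar> = (excess \<epsilon> s)\<^sup>2"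
  using assms by (auto simp: soft_def excess_def max_def abs_if)

text \<open>
  \<open>bump (log_dist N a p)\<close> is a logarithmic cutoff, both near \<open>a\<close> and at infinity; its Dirichlet
  integral is of order \<open>1 / N\<close> since both have capacity zero in the plane.  Note that
  \<open>ln 0 = 0\<close> makes it 1 at \<open>a\<close> itself.
\<close>

definition log_dist :: "nat \<Rightarrow> plane \<Rightarrow> plane \<Rightarrow> real" where
  "log_dist N a p = ln ((norm (p - a))\<^sup>2) / N"

definition bump :: "real \<Rightarrow> real" where
  "bump s = max 0 (1 - s\<^sup>2)"

text \<open>Squaring smooths the kink of \<open>bump\<close> at 1 and -1, which is why the cutoffs
  enter the test function squared.\<close>

lemma bump_square_deriv: "((\<lambda>s. (bump s)\<^sup>2) has_real_derivative - 4 * bump s * s) (at s)"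
proof -
  have "((\<lambda>s. (max 0 (1 - s\<^sup>2))\<^sup>2) has_real_derivative 2 * max 0 (1 - s\<^sup>2) * (- 2 * s)) (at s)"
    by (rule DERIV_chain2[OF pos_part_square_deriv]) (auto intro!: derivative_eq_intros)
  then show ?thesis by (simp add: bump_def algebra_simps)
qed

lemma bump_bounds: "0 \<le> bump s" "bump s \<le> 1" "bump s \<noteq> 0 \<Longrightarrow> \<bar>s\<bar> < 1"
  using abs_square_less_1[of s] by (auto simp: bump_def max_def split: if_splits)

lemma bump_eq_0: "1 \<le> \<bar>s\<bar> \<Longrightarrow> bump s = 0"
  using abs_square_less_1[of s] by (auto simp: bump_def max_def)

lemma log_dist_GDERIV:
  assumes "p \<noteq> a"
  shows "GDERIV (log_dist N a) p :> (2 / (N * (norm (p - a))\<^sup>2)) *\<^sub>R (p - a)"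
proof -
  have pos: "(p - a) \<bullet> (p - a) > 0" using assms by simp
  have "GDERIV (\<lambda>p. (p - a) \<bullet> (p - a)) p :> 2 *\<^sub>R (p - a)"
    unfolding gderiv_def
    by (auto intro!: derivative_eq_intros simp: inner_commute algebra_simps inner_diff_left)
  from GDERIV_DERIV_compose[OF this DERIV_cdivide[OF DERIV_ln_divide[OF pos], of "real N"]]
  show ?thesis
    by (simp add: log_dist_def[abs_def] power2_norm_eq_inner mult.commute)
qed

text \<open>The factor \<open>1 / N^2\<close>, against the growth \<open>N\<close> in
  \<open>integral_ring_sum\<close>, is the source of the decay \<open>1 / N\<close>. At
  \<open>p = a\<close> both sides are 0 because division by 0 yields 0.\<close>

lemma norm_log_dist_gradient:
  "(norm ((2 / (real N * (norm (p - a))\<^sup>2)) *\<^sub>R (p - a)))\<^sup>2 = 4 / (real N)\<^sup>2 * (1 / (norm (p - a))\<^sup>2)"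
  by (cases "p = a") (simp_all add: power_mult_distrib power_divide, simp add: power2_eq_square power4_eq_xxxx)

text \<open>
  A majorant of the inverse square distance on the ring
  \<open>exp (- N) < (norm (p - a))\<^sup>2 < exp N\<close> that can be integrated without polar coordinates: every
  summand has the same integral over the plane.
\<close>

definition ring_sum :: "nat \<Rightarrow> plane \<Rightarrow> plane \<Rightarrow> real" where
  "ring_sum N a p =
     (\<Sum>k<2*N. exp (real N - k) * indicator (cball a (exp ((real k + 1 - N) / 2))) p)"

lemma ring_sum_nonneg: "0 \<le> ring_sum N a p"
  by (auto simp: ring_sum_def intro!: sum_nonneg)

text \<open>One summand suffices: for \<open>L = ln ((norm (p - a))\<^sup>2)\<close> and
  \<open>k\<close> the floor of \<open>L\<close> plus \<open>N\<close>, the disc has squared radius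
  \<open>exp\<close> of floor plus 1, so it contains \<open>p\<close>, and the weight is
  \<open>exp\<close> of minus the floor, at least \<open>exp (- L)\<close>.\<close>

lemma inverse_square_le_ring_sum:
  assumes "\<bar>log_dist N a p\<bar> < 1" and "p \<noteq> a" and N: "0 < N"
  shows "1 / (norm (p - a))\<^sup>2 \<le> ring_sum N a p"
proof -
  define L where "L = ln ((norm (p - a))\<^sup>2)"
  have L: "\<bar>L\<bar> < N" using assms by (simp add: log_dist_def L_def)
  have expL: "exp L = (norm (p - a))\<^sup>2" using assms by (simp add: L_def)
  \<comment> \<open>The shift by \<open>N\<close> makes the index natural; the strict bound
    \<open>L < N\<close> keeps it below \<open>2 * N\<close>.\<close>
  define k where "k = nat (\<lfloor>L\<rfloor> + int N)"
  have "\<lfloor>L\<rfloor> + int N \<ge> 0" using L by linarith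
  then have k: "real k = of_int \<lfloor>L\<rfloor> + real N" by (simp add: k_def)
  have kN: "k < 2 * N" using L k by linarith
  have "norm (p - a) = sqrt (exp L)" using expL by simp
  also have "\<dots> = exp (L / 2)"
    by (rule real_sqrt_unique) (simp_all add: power2_eq_square flip: exp_add)
  also have "\<dots> \<le> exp ((real k + 1 - N) / 2)"
    using k real_of_int_floor_add_one_ge[of L] by simp
  finally have mem: "p \<in> cball a (exp ((real k + 1 - N) / 2))"
    by (simp add: dist_norm norm_minus_commute)
  have "1 / (norm (p - a))\<^sup>2 = exp (- L)" by (simp add: exp_minus expL divide_inverse)
  also have "\<dots> \<le> exp (real N - k)" using k by simp
  also have "\<dots> = exp (real N - k) * indicator (cball a (exp ((real k + 1 - N) / 2))) p"
    using mem by simp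
  also have "\<dots> \<le> ring_sum N a p"
    unfolding ring_sum_def using kN by (intro member_le_sum) auto
  finally show ?thesis .
qed

lemma integral_ring_sum:
  "ring_sum N a integrable_on cbox c d"
  "integral (cbox c d) (ring_sum N a) \<le> 2 * real N * (exp 1 * unit_ball_vol 2)"
proof -
  let ?I = "\<lambda>k. indicator (cball a (exp ((real k + 1 - N) / 2))) :: plane \<Rightarrow> real"
  have U: "(?I k has_integral measure lebesgue (cball a (exp ((real k + 1 - N) / 2)))) UNIV" for k
    using lmeasurable_iff_indicator_has_integral lmeasurable_cball by blast
  have c: "?I k integrable_on cbox c d" for k
    using U integrable_on_subcbox by blast
  have le: "integral (cbox c d) (?I k) \<le> exp (real k + 1 - N) * unit_ball_vol 2" for k
  proof -
    have "integral (cbox c d) (?I k) \<le> integral UNIV (?I k)"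
      by (rule integral_subset_le) (use U c in auto)
    also have "\<dots> = unit_ball_vol 2 * (exp ((real k + 1 - N) / 2))\<^sup>2"
      by (simp add: integral_unique[OF U] content_cball power2_eq_square)
    also have "(exp ((real k + 1 - N) / 2))\<^sup>2 = exp (real k + 1 - N)"
      by (simp add: power2_eq_square flip: exp_add)
    finally show ?thesis by (simp add: mult.commute)
  qed
  show "ring_sum N a integrable_on cbox c d"
    unfolding ring_sum_def[abs_def] by (intro integrable_sum integrable_on_mult_right c) auto
  have "integral (cbox c d) (ring_sum N a) = (\<Sum>k<2*N. exp (real N - k) * integral (cbox c d) (?I k))"
    unfolding ring_sum_def[abs_def]
    by (subst integral_sum) (auto intro!: integrable_on_mult_right c)
  also have "\<dots> \<le> (\<Sum>k<2*N. exp (real N - k) * (exp (real k + 1 - N) * unit_ball_vol 2))"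
    by (intro sum_mono mult_left_mono le) auto
  also have "\<dots> = (\<Sum>k<2*N. exp 1 * unit_ball_vol 2)"
    by (intro sum.cong) (auto simp: mult.assoc[symmetric] simp flip: exp_add)
  finally show "integral (cbox c d) (ring_sum N a) \<le> 2 * real N * (exp 1 * unit_ball_vol 2)" by simp
qed



text \<open>The Caccioppoli estimate before integration. In the application \<open>m\<close> and
  \<open>n\<close> are the cutoffs of the two tips, \<open>r\<close> and \<open>s\<close> their
  logarithmic distances with gradients \<open>X\<close> and \<open>Y\<close>, \<open>t\<close> is
  \<open>excess\<close> and \<open>f\<close> is \<open>soft\<close>; the vector paired with
  \<open>W\<close> is then the gradient of the test function. It supplies the energy twice, and one
  copy absorbs the terms in which a cutoff is differentiated.\<close>

lemma caccioppoli_pointwise: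
  fixes U W X Y :: plane and r s t f m n :: real
  assumes m: "0 \<le> m" "m \<le> 1" "m \<noteq> 0 \<Longrightarrow> \<bar>r\<bar> < 1" and n: "0 \<le> n" "n \<le> 1" "n \<noteq> 0 \<Longrightarrow> \<bar>s\<bar> < 1"
    and t: "0 \<le> t" and f: "\<bar>f\<bar> = t\<^sup>2"
    and lo: "\<mu> * (norm U)\<^sup>2 \<le> U \<bullet> W" and up: "norm W \<le> \<Lambda> * norm U" and l: "0 < \<mu>"
    and XY: "m \<noteq> 0 \<Longrightarrow> n \<noteq> 0 \<Longrightarrow> (norm X)\<^sup>2 + (norm Y)\<^sup>2 \<le> Q" and Q: "0 \<le> Q"
  shows "\<mu> * ((m * n)\<^sup>2 * t * (norm U)\<^sup>2)
    \<le> ((m\<^sup>2 * n\<^sup>2 * (2 * t)) *\<^sub>R U + f *\<^sub>R (m\<^sup>2 *\<^sub>R (- 4 * n * s) *\<^sub>R Y + n\<^sup>2 *\<^sub>R (- 4 * m * r) *\<^sub>R X)) \<bullet> W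
      + 8 * \<Lambda>\<^sup>2 / \<mu> * t ^ 3 * Q"
proof (cases "m = 0 \<or> n = 0")
  \<comment> \<open>\<open>XY\<close> gives no bound here, but every term except the nonnegative
    remainder vanishes.\<close>
  case True
  have "0 \<le> 8 * \<Lambda>\<^sup>2 / \<mu> * t ^ 3 * Q" using t l Q by simp
  with True show ?thesis by auto
next
  case False
  \<comment> \<open>In the application, minus half the gradient of the product cutoff
    \<open>m * n\<close>, because \<open>bump\<close> has slope \<open>- 2 * s\<close> where it is
    positive.\<close>
  define e where "e = (m * s) *\<^sub>R Y + (n * r) *\<^sub>R X"
  let ?\<eta> = "m * n"
  have ms: "\<bar>m * s\<bar> \<le> 1 * 1" "\<bar>n * r\<bar> \<le> 1 * 1"
    unfolding abs_mult using m n False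
    by (intro mult_mono; simp)+
  have "norm e \<le> \<bar>m * s\<bar> * norm Y + \<bar>n * r\<bar> * norm X"
    unfolding e_def by (rule norm_triangle_le) simp
  also have "\<dots> \<le> 1 * norm Y + 1 * norm X"
    using ms by (intro add_mono mult_right_mono) auto
  finally have "norm e \<le> norm X + norm Y" by simp
  then have "(norm e)\<^sup>2 \<le> (norm X + norm Y)\<^sup>2" by (intro power_mono) auto
  also have "\<dots> \<le> 2 * ((norm X)\<^sup>2 + (norm Y)\<^sup>2)"
    using sum_squares_bound[of "norm X" "norm Y"] by (simp add: power2_sum)
  also have "\<dots> \<le> 2 * Q" using XY False by simp
  finally have eQ: "(norm e)\<^sup>2 \<le> 2 * Q" .
  have L: "0 \<le> \<Lambda> * norm U" using up norm_ge_zero order_trans by blast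
  have eq: "((m\<^sup>2 * n\<^sup>2 * (2 * t)) *\<^sub>R U + f *\<^sub>R (m\<^sup>2 *\<^sub>R (- 4 * n * s) *\<^sub>R Y + n\<^sup>2 *\<^sub>R (- 4 * m * r) *\<^sub>R X)) \<bullet> W
    = 2 * ?\<eta>\<^sup>2 * t * (U \<bullet> W) - 4 * ?\<eta> * f * (e \<bullet> W)"
    by (simp add: e_def inner_add_left algebra_simps power2_eq_square)
  have "\<bar>4 * ?\<eta> * f * (e \<bullet> W)\<bar> = 4 * ?\<eta> * t\<^sup>2 * \<bar>e \<bullet> W\<bar>"
    using m n f by (simp add: abs_mult)
  also have "\<dots> \<le> 4 * ?\<eta> * t\<^sup>2 * (norm e * (\<Lambda> * norm U))"
    using m n order_trans[OF Cauchy_Schwarz_ineq2 mult_left_mono[OF up norm_ge_zero], of e]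
    by (intro mult_left_mono) auto
  finally have 1: "\<bar>4 * ?\<eta> * f * (e \<bullet> W)\<bar> \<le> t * (4 * (?\<eta> * norm U) * (t * \<Lambda> * norm e))"
    by (simp add: algebra_simps power2_eq_square)
  \<comment> \<open>Young's inequality, weighted so that the first term is exactly one of the two
    copies of the energy.\<close>
  have "4 * A * C \<le> \<mu> * A\<^sup>2 + 4 / \<mu> * C\<^sup>2" for A C
  proof -
    have "0 \<le> (\<mu> * A - 2 * C)\<^sup>2 / \<mu>" using l by simp
    also have "\<dots> = \<mu> * A\<^sup>2 + 4 / \<mu> * C\<^sup>2 - 4 * A * C"
      using l by (simp add: power2_eq_square field_simps)
    finally show ?thesis by simp
  qed
  then have "t * (4 * (?\<eta> * norm U) * (t * \<Lambda> * norm e))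
    \<le> t * (\<mu> * (?\<eta> * norm U)\<^sup>2 + 4 / \<mu> * (t * \<Lambda> * norm e)\<^sup>2)"
    using t by (intro mult_left_mono)
  also have "\<dots> = \<mu> * (?\<eta>\<^sup>2 * t * (norm U)\<^sup>2) + 4 * \<Lambda>\<^sup>2 / \<mu> * t ^ 3 * (norm e)\<^sup>2"
    by (simp add: algebra_simps power2_eq_square power3_eq_cube)
  also have "\<dots> \<le> \<mu> * (?\<eta>\<^sup>2 * t * (norm U)\<^sup>2) + 4 * \<Lambda>\<^sup>2 / \<mu> * t ^ 3 * (2 * Q)"
    using eQ l t by (intro add_left_mono mult_left_mono) auto
  finally have 2: "\<bar>4 * ?\<eta> * f * (e \<bullet> W)\<bar>
    \<le> \<mu> * (?\<eta>\<^sup>2 * t * (norm U)\<^sup>2) + 8 * \<Lambda>\<^sup>2 / \<mu> * t ^ 3 * Q" using 1 by simp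
  have "2 * ?\<eta>\<^sup>2 * t * (\<mu> * (norm U)\<^sup>2) \<le> 2 * ?\<eta>\<^sup>2 * t * (U \<bullet> W)"
    using lo t by (intro mult_left_mono) auto
  with 2 show ?thesis unfolding eq by (simp add: algebra_simps)
qed

section \<open>Bounded solutions vanishing on the plate\<close>

lemma excess_bounds: "0 \<le> excess \<epsilon> s" "0 < \<epsilon> \<Longrightarrow> \<bar>s\<bar> \<le> M \<Longrightarrow> excess \<epsilon> s \<le> M"
  "\<bar>s\<bar> < \<epsilon> \<Longrightarrow> excess \<epsilon> s = 0"
  by (auto simp: excess_def)

lemma log_dist_near: "\<exists>e>0. \<forall>q\<in>ball a e - {a}. 1 \<le> \<bar>log_dist N a q\<bar>" if "0 < N"
proof (intro exI[of _ "exp (- real N / 2)"] conjI ballI)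
  fix q assume q: "q \<in> ball a (exp (- real N / 2)) - {a}"
  then have "norm (q - a) < exp (- real N / 2)" by (simp add: dist_norm norm_minus_commute)
  then have "ln (norm (q - a)) < - real N / 2"
    using q ln_less_cancel_iff[of "norm (q - a)" "exp (- real N / 2)"] by simp
  then have "ln ((norm (q - a))\<^sup>2) \<le> - N"
    using q by (simp add: ln_realpow)
  then show "1 \<le> \<bar>log_dist N a q\<bar>"
    using that by (simp add: log_dist_def abs_if field_simps)
qed auto

lemma log_dist_far: "exp (real N / 2) \<le> norm (q - a) \<Longrightarrow> 0 < N \<Longrightarrow> 1 \<le> \<bar>log_dist N a q\<bar>"
proof -
  assume *: "exp (real N / 2) \<le> norm (q - a)" "0 < N"
  then have pos: "0 < norm (q - a)" using exp_gt_zero less_le_trans by blast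
  have "real N / 2 \<le> ln (norm (q - a))" using * ln_ge_iff[OF pos] by blast
  moreover have "ln ((norm (q - a))\<^sup>2) = 2 * ln (norm (q - a))" using pos by (simp add: ln_realpow)
  ultimately have "real N \<le> ln ((norm (q - a))\<^sup>2)" by linarith
  then show ?thesis using * by (simp add: log_dist_def abs_if field_simps)
qed

text \<open>Common frame for both kinds of flow, with \<open>u\<close> the normal velocity,
  \<open>U\<close> its gradient and \<open>W\<close> the flux. The witness \<open>d\<close> encodes
  that \<open>W\<close> is divergence free; \<open>lower\<close> and \<open>upper\<close> are the
  ellipticity. The condition \<open>boundary\<close> leaves out the tips, which the cutoffs take
  care of.\<close>

locale bounded_flux =
  fixes a b :: plane and u d :: "plane \<Rightarrow> real" and U W :: "plane \<Rightarrow> plane" and \<mu> \<Lambda> M :: real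
  assumes ab: "a \<noteq> b"
    and grad: "\<And>p. p \<notin> closed_segment a b \<Longrightarrow> GDERIV u p :> U p"
    and U: "continuous_on (- closed_segment a b) U"
    and W: "continuous_on (- closed_segment a b) W"
    and d: "continuous_on (- closed_segment a b) d"
    and Wx: "\<And>x y. (x, y) \<notin> closed_segment a b \<Longrightarrow>
      ((\<lambda>x. fst (W (x, y))) has_real_derivative d (x, y)) (at x)"
    and Wy: "\<And>x y. (x, y) \<notin> closed_segment a b \<Longrightarrow>
      ((\<lambda>y. snd (W (x, y))) has_real_derivative - d (x, y)) (at y)"
    and mu: "0 < \<mu>"
    and lower: "\<And>p. p \<notin> closed_segment a b \<Longrightarrow> \<mu> * (norm (U p))\<^sup>2 \<le> U p \<bullet> W p"
    and upper: "\<And>p. p \<notin> closed_segment a b \<Longrightarrow> norm (W p) \<le> \<Lambda> * norm (U p)"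
    and bnd: "\<And>p. p \<notin> closed_segment a b \<Longrightarrow> \<bar>u p\<bar> \<le> M"
    and boundary: "\<And>p. p \<in> open_segment a b \<Longrightarrow> (u \<longlongrightarrow> 0) (at p within - closed_segment a b)"
begin

abbreviation "\<Omega> \<equiv> - closed_segment a b"

lemma continuous_on_u: "continuous_on \<Omega> u"
  using grad by (auto intro!: continuous_at_imp_continuous_on dest!: has_derivative_continuous simp: gderiv_def)

lemma vanishes_near:
  assumes "p \<in> open_segment a b" and "0 < \<epsilon>"
  shows "\<exists>e>0. \<forall>q\<in>ball p e - closed_segment a b. \<bar>u q\<bar> < \<epsilon>"
proof -
  have "p \<in> closed_segment a b" using assms by (auto simp: open_segment_def)
  moreover from boundary[OF assms(1)] assms(2) obtain e where "e > 0"
    "\<forall>q\<in>\<Omega>. 0 < dist q p \<and> dist q p < e \<longrightarrow> dist (u q) 0 < \<epsilon>"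
    unfolding Lim_within by blast
  ultimately show ?thesis
    by (intro exI[of _ e]) (auto simp: dist_commute)
qed

definition cut :: "nat \<Rightarrow> plane \<Rightarrow> real" where
  "cut N p = bump (log_dist N a p) * bump (log_dist N b p)"

text \<open>The test function integrates to 0 against \<open>W\<close>, so integrating the pointwise
  estimate bounds the energy by its remainder. A lower bound \<open>c\<close> for the energy density
  on a box stands in for the energy itself, so that on the left just an indicator is integrated. The
  constant is \<open>8 * 4 * 4\<close>: 8 from the pointwise estimate, 4 from the squared gradient,
  and \<open>4 * N\<close> from \<open>2 * N\<close> discs around each of the two tips.\<close>

lemma energy_estimate:
  assumes \<epsilon>: "0 < \<epsilon>" and N: "0 < N"
    and K: "cbox k1 k2 \<subseteq> \<Omega>" "cbox k1 k2 \<subseteq> ball 0 r"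
    and c: "\<And>p. p \<in> cbox k1 k2 \<Longrightarrow> c \<le> (cut N p)\<^sup>2 * excess \<epsilon> (u p) * (norm (U p))\<^sup>2"
  shows "\<mu> * c * measure lborel (cbox k1 k2) \<le> 128 * \<Lambda>\<^sup>2 / \<mu> * M ^ 3 * exp 1 * unit_ball_vol 2 / N"
proof -
  define G where "G p = ((bump (log_dist N a p))\<^sup>2 * (bump (log_dist N b p))\<^sup>2) * soft \<epsilon> (u p)" for p
  define X where "X c p = (2 / (real N * (norm (p - c))\<^sup>2)) *\<^sub>R (p - c)" for c p :: plane
  define DG where "DG p =
    ((bump (log_dist N a p))\<^sup>2 * (bump (log_dist N b p))\<^sup>2 * (2 * excess \<epsilon> (u p))) *\<^sub>R U p
    + soft \<epsilon> (u p) *\<^sub>R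
      ((bump (log_dist N a p))\<^sup>2 *\<^sub>R (- 4 * bump (log_dist N b p) * log_dist N b p) *\<^sub>R X b p
       + (bump (log_dist N b p))\<^sup>2 *\<^sub>R (- 4 * bump (log_dist N a p) * log_dist N a p) *\<^sub>R X a p)" for p
  \<comment> \<open>Large enough for the square to contain the box, and for the cutoff around
    \<open>a\<close> to vanish wherever the norm is at least \<open>R\<close>.\<close>
  define R where "R = max 1 (max r (norm a + exp (real N / 2)))"
  define T where "T p = (if p \<in> closed_segment a b then 0 else DG p \<bullet> W p)" for p
  define C where "C = 8 * \<Lambda>\<^sup>2 / \<mu> * M ^ 3 * (4 / (real N)\<^sup>2)"
  have ends: "a \<in> closed_segment a b" "b \<in> closed_segment a b" by auto
  have Xd: "GDERIV (log_dist N e) p :> X e p" if "p \<noteq> e" for e p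
    unfolding X_def using that by (rule log_dist_GDERIV)
  have lc: "continuous_on \<Omega> (log_dist N e)" if "e \<in> closed_segment a b" for e
  proof (intro continuous_at_imp_continuous_on ballI)
    fix p assume "p \<in> \<Omega>"
    with that have "p \<noteq> e" by blast
    from Xd[OF this] show "isCont (log_dist N e) p"
      unfolding gderiv_def by (rule has_derivative_continuous)
  qed
  have DGc: "continuous_on \<Omega> DG"
  proof -
    have bc: "continuous_on \<Omega> (\<lambda>p. bump (log_dist N e p))" if "e \<in> closed_segment a b" for e
      unfolding bump_def by (intro continuous_intros lc that)
    have sc: "continuous_on \<Omega> (\<lambda>p. soft \<epsilon> (u p))" "continuous_on \<Omega> (\<lambda>p. excess \<epsilon> (u p))"
      unfolding soft_def excess_def by (intro continuous_intros continuous_on_u)+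
    have Xc: "continuous_on \<Omega> (X e)" if "e \<in> closed_segment a b" for e
      unfolding X_def[abs_def] using that N by (intro continuous_intros) auto
    show ?thesis
      unfolding DG_def[abs_def] by (intro continuous_intros U bc sc Xc lc ends)
  qed
  have Gd: "GDERIV G p :> DG p" if p: "p \<notin> closed_segment a b" for p
  proof -
    have ne: "p \<noteq> a" "p \<noteq> b" using p ends by auto
    have A: "GDERIV (\<lambda>p. (bump (log_dist N e p))\<^sup>2) p :> (- 4 * bump (log_dist N e p) * log_dist N e p) *\<^sub>R X e p"
      if "p \<noteq> e" for e
      by (rule GDERIV_DERIV_compose[OF Xd[OF that] bump_square_deriv])
    have S: "GDERIV (\<lambda>p. soft \<epsilon> (u p)) p :> (2 * excess \<epsilon> (u p)) *\<^sub>R U p"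
      by (rule GDERIV_DERIV_compose[OF grad[OF p] soft_deriv[OF \<epsilon>]])
    from GDERIV_mult[OF GDERIV_mult[OF A[OF ne(1)] A[OF ne(2)]] S]
    show ?thesis unfolding G_def[abs_def] DG_def by (simp add: add.commute)
  qed
  have near: "\<exists>e>0. \<forall>q\<in>ball p e - closed_segment a b. G q = 0" if p: "p \<in> closed_segment a b" for p
  proof (cases "p = a \<or> p = b")
    case True
    then have "\<exists>e>0. \<forall>q\<in>ball p e - {p}. G q = 0"
    proof
      assume "p = a"
      with log_dist_near[OF N, of a] show ?thesis by (auto simp: G_def dest!: bump_eq_0)
    next
      assume "p = b"
      with log_dist_near[OF N, of b] show ?thesis by (auto simp: G_def dest!: bump_eq_0)
    qed
    with p show ?thesis by fastforce
  next
    case False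
    with p have "p \<in> open_segment a b" by (auto simp: open_segment_def)
    from vanishes_near[OF this \<epsilon>] obtain e where e: "e > 0"
      "\<forall>q\<in>ball p e - closed_segment a b. \<bar>u q\<bar> < \<epsilon>" by blast
    have "G q = 0" if "\<bar>u q\<bar> < \<epsilon>" for q
      using abs_soft[OF \<epsilon>, of "u q"] excess_bounds(3)[OF that] by (simp add: G_def)
    with e show ?thesis by blast
  qed
  have far: "G p = 0" if "R \<le> norm p" for p
  proof -
    have "exp (real N / 2) \<le> norm (p - a)"
      using that norm_triangle_ineq2[of p a] by (simp add: R_def)
    from bump_eq_0[OF log_dist_far[OF this N]] show ?thesis by (simp add: G_def)
  qed
  have T0: "(T has_integral 0) (cbox (-R, -R) (R, R))"
    unfolding T_def
    by (rule integral_test_function[OF closed_segment Gd DGc W d Wx Wy near far])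
      (auto simp: R_def)
  \<comment> \<open>Any point off the plate shows \<open>0 \<le> M\<close>, as \<open>M\<close>
    bounds an absolute value there.\<close>
  obtain q where "q \<notin> closed_segment a b"
    using bounded_closed_segment[of a b] not_bounded_UNIV[where 'a=plane] by (metis UNIV_eq_I)
  then have C: "0 \<le> C"
    using bnd[of q] mu by (auto simp: C_def intro!: mult_nonneg_nonneg divide_nonneg_nonneg)
  have point: "\<mu> * ((cut N p)\<^sup>2 * excess \<epsilon> (u p) * (norm (U p))\<^sup>2) \<le> T p + C * (ring_sum N a p + ring_sum N b p)"
    if p: "p \<notin> closed_segment a b" for p
  proof -
    have ne: "p \<noteq> a" "p \<noteq> b" using p ends by auto
    let ?t = "excess \<epsilon> (u p)" and ?Q = "4 / (real N)\<^sup>2 * (ring_sum N a p + ring_sum N b p)"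
    have "\<mu> * ((bump (log_dist N a p) * bump (log_dist N b p))\<^sup>2 * ?t * (norm (U p))\<^sup>2)
      \<le> DG p \<bullet> W p + 8 * \<Lambda>\<^sup>2 / \<mu> * ?t ^ 3 * ?Q"
      unfolding DG_def
    proof (rule caccioppoli_pointwise)
      assume "bump (log_dist N a p) \<noteq> 0" "bump (log_dist N b p) \<noteq> 0"
      then have "1 / (norm (p - a))\<^sup>2 \<le> ring_sum N a p" "1 / (norm (p - b))\<^sup>2 \<le> ring_sum N b p"
        using inverse_square_le_ring_sum N ne bump_bounds(3) by blast+
      then have "4 / (real N)\<^sup>2 * (1 / (norm (p - a))\<^sup>2) + 4 / (real N)\<^sup>2 * (1 / (norm (p - b))\<^sup>2) \<le> ?Q"
        unfolding distrib_left by (intro add_mono mult_left_mono) auto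
      then show "(norm (X a p))\<^sup>2 + (norm (X b p))\<^sup>2 \<le> ?Q"
        unfolding X_def norm_log_dist_gradient .
    qed (use bump_bounds excess_bounds \<epsilon> abs_soft lower[OF p] upper[OF p] mu ring_sum_nonneg in auto)
    also have "8 * \<Lambda>\<^sup>2 / \<mu> * ?t ^ 3 * ?Q \<le> 8 * \<Lambda>\<^sup>2 / \<mu> * M ^ 3 * ?Q"
      using excess_bounds(1) excess_bounds(2)[OF \<epsilon> bnd[OF p]] mu ring_sum_nonneg
      by (intro mult_right_mono mult_left_mono power_mono) auto
    finally show ?thesis using p by (simp add: T_def C_def cut_def algebra_simps)
  qed
  have pointwise: "\<mu> * c * indicator (cbox k1 k2) p \<le> T p + C * (ring_sum N a p + ring_sum N b p)" for p
  proof (cases "p \<in> cbox k1 k2")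
    case True
    then have "\<mu> * c \<le> \<mu> * ((cut N p)\<^sup>2 * excess \<epsilon> (u p) * (norm (U p))\<^sup>2)"
      using c mu by (intro mult_left_mono) auto
    also have "\<dots> \<le> T p + C * (ring_sum N a p + ring_sum N b p)"
      using True K by (intro point) auto
    finally show ?thesis using True by simp
  next
    case False
    show ?thesis
    proof (cases "p \<in> closed_segment a b")
      case True
      from C True False show ?thesis
        by (auto simp: T_def ring_sum_nonneg intro!: mult_nonneg_nonneg add_nonneg_nonneg)
    next
      case p: False
      \<comment> \<open>\<open>T\<close> itself may be negative here; nonnegativity of the
        right-hand side comes from \<open>point\<close>.\<close>
      have "0 \<le> \<mu> * ((cut N p)\<^sup>2 * excess \<epsilon> (u p) * (norm (U p))\<^sup>2)"
        using mu excess_bounds(1) by auto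
      with point[OF p] False show ?thesis by simp
    qed
  qed
  let ?B = "cbox (-R, -R) (R, R) :: plane set"
  have sub: "cbox k1 k2 \<subseteq> ?B"
  proof
    fix p assume "p \<in> cbox k1 k2"
    then have "norm p < R" using K by (auto simp: R_def)
    then show "p \<in> ?B"
      using norm_fst_le[of "fst p" "snd p"] norm_snd_le[of "snd p" "fst p"]
      by (cases p) (auto simp: abs_le_iff)
  qed
  have "((\<lambda>_. 1) has_integral measure lborel (cbox k1 k2)) (cbox k1 k2)"
    using has_integral_const[of "1::real" k1 k2] by simp
  then have "(indicator (cbox k1 k2) has_integral measure lborel (cbox k1 k2)) (cbox k1 k2)"
    by (rule has_integral_eq[rotated]) auto
  then have "(indicator (cbox k1 k2) has_integral measure lborel (cbox k1 k2)) ?B"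
    by (rule has_integral_on_superset) (use sub in auto)
  then have I1: "((\<lambda>p. \<mu> * c * indicator (cbox k1 k2) p) has_integral \<mu> * c * measure lborel (cbox k1 k2)) ?B"
    by (rule has_integral_mult_right)
  have I2: "((\<lambda>p. T p + C * (ring_sum N a p + ring_sum N b p)) has_integral
      0 + C * (integral ?B (ring_sum N a) + integral ?B (ring_sum N b))) ?B"
    by (intro has_integral_add T0 has_integral_mult_right integrable_integral integral_ring_sum)
  have "\<mu> * c * measure lborel (cbox k1 k2)
      \<le> 0 + C * (integral ?B (ring_sum N a) + integral ?B (ring_sum N b))"
    by (rule has_integral_le[OF I1 I2]) (rule pointwise)
  also have "\<dots> \<le> 0 + C * (2 * real N * (exp 1 * unit_ball_vol 2) + 2 * real N * (exp 1 * unit_ball_vol 2))"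
    by (intro add_left_mono mult_left_mono add_mono integral_ring_sum C)
  also have "\<dots> = 128 * \<Lambda>\<^sup>2 / \<mu> * M ^ 3 * exp 1 * unit_ball_vol 2 / N"
    using N by (simp add: C_def field_simps power2_eq_square)
  finally show ?thesis .
qed

text \<open>Otherwise the product stays above half its value on a box around \<open>p\<close>, and
  \<open>energy_estimate\<close> fails for large \<open>N\<close>.\<close>

lemma excess_mult_gradient_eq_0:
  assumes p: "p \<notin> closed_segment a b" and \<epsilon>: "0 < \<epsilon>"
  shows "excess \<epsilon> (u p) * (norm (U p))\<^sup>2 = 0"
proof (rule ccontr)
  define f where "f q = excess \<epsilon> (u q) * (norm (U q))\<^sup>2" for q
  assume "excess \<epsilon> (u p) * (norm (U p))\<^sup>2 \<noteq> 0"
  then have fp: "f p > 0"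
    using excess_bounds(1)[of \<epsilon> "u p"] by (simp add: f_def less_le)
  have op: "open \<Omega>" by (simp add: open_Compl)
  have "continuous_on \<Omega> f"
    unfolding f_def excess_def by (intro continuous_intros continuous_on_u U)
  then have "open (\<Omega> \<inter> f -` {f p / 2<..})"
    using op continuous_on_open_vimage[OF op] by (metis Int_commute open_greaterThan)
  then obtain k1 k2 where k: "cbox k1 k2 \<subseteq> \<Omega> \<inter> f -` {f p / 2<..}" "p \<in> box k1 k2"
    using p fp by (elim open_contains_cbox[of _ p]) auto
  then have vol: "0 < measure lborel (cbox k1 k2)"
    by (intro content_pos_lt) (auto simp: mem_box intro: less_trans)
  have "\<exists>L. \<forall>q\<in>cbox k1 k2. \<bar>ln ((norm (q - e))\<^sup>2)\<bar> \<le> L" if "e \<in> closed_segment a b" for e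
  proof -
    have "continuous_on (cbox k1 k2) (\<lambda>q. ln ((norm (q - e))\<^sup>2))"
      using k that by (intro continuous_intros) auto
    then have "bounded ((\<lambda>q. ln ((norm (q - e))\<^sup>2)) ` cbox k1 k2)"
      by (intro compact_imp_bounded compact_continuous_image) auto
    then show ?thesis by (auto simp: bounded_iff)
  qed
  then obtain La Lb where L: "\<And>q. q \<in> cbox k1 k2 \<Longrightarrow> \<bar>ln ((norm (q - a))\<^sup>2)\<bar> \<le> La"
    "\<And>q. q \<in> cbox k1 k2 \<Longrightarrow> \<bar>ln ((norm (q - b))\<^sup>2)\<bar> \<le> Lb"
    by (meson ends_in_segment)
  obtain r where r: "cbox k1 k2 \<subseteq> ball 0 r"
    using bounded_subset_ballD[OF bounded_cbox] by blast
  define D where "D = 128 * \<Lambda>\<^sup>2 / \<mu> * M ^ 3 * exp 1 * unit_ball_vol 2"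
  \<comment> \<open>The fraction \<open>1 / 8\<close> is a quarter times a half: on the box the
    squared cutoff is at least \<open>1 / 4\<close> and the product at least
    \<open>f p / 2\<close>.\<close>
  define A where "A = \<mu> * (f p / 8) * measure lborel (cbox k1 k2)"
  have A: "A > 0" using mu fp vol by (simp add: A_def)
  \<comment> \<open>Twice \<open>La\<close> and \<open>Lb\<close> bring both logarithmic distances
    down to \<open>1 / 2\<close> on the box, where \<open>bump\<close> is at least
    \<open>3 / 4\<close>; exceeding \<open>D / A\<close> contradicts
    \<open>A \<le> D / N\<close>.\<close>
  obtain N :: nat where N: "max (max 1 (D / A + 1)) (max (2 * La) (2 * Lb)) \<le> N"
    using real_arch_simple by blast
  then have N0: "0 < N" by (cases "N = 0") auto
  have "A \<le> D / N"
    unfolding A_def D_def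
  proof (rule energy_estimate[OF \<epsilon> N0 _ r])
    fix q assume q: "q \<in> cbox k1 k2"
    have half: "3 / 4 \<le> bump s" if "\<bar>s\<bar> \<le> 1 / 2" for s
      using power_mono[OF that, of 2] by (simp add: bump_def power2_eq_square)
    have "\<bar>log_dist N a q\<bar> \<le> 1 / 2" "\<bar>log_dist N b q\<bar> \<le> 1 / 2"
      using L[OF q] N N0 by (auto simp: log_dist_def field_simps)
    then have "3 / 4 * (3 / 4) \<le> cut N q"
      unfolding cut_def by (intro mult_mono half) (auto simp: bump_bounds)
    then have "(1 / 2)\<^sup>2 \<le> (cut N q)\<^sup>2" by (intro power_mono) auto
    moreover have "f p / 2 \<le> f q" using k q by force
    ultimately have "(1 / 2)\<^sup>2 * (f p / 2) \<le> (cut N q)\<^sup>2 * f q"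
      using fp by (intro mult_mono) auto
    then show "f p / 8 \<le> (cut N q)\<^sup>2 * excess \<epsilon> (u q) * (norm (U q))\<^sup>2"
      by (simp add: f_def power2_eq_square mult.assoc)
  qed (use k in auto)
  then have "A * N \<le> D" using N0 by (simp add: field_simps)
  moreover have "D / A < N" using N by auto
  ultimately show False using A by (simp add: field_simps)
qed

text \<open>The gradient of \<open>soft \<epsilon> u\<close> contains the factor
  \<open>excess \<epsilon> u\<close> times \<open>U\<close>, which is now 0. So
  \<open>soft \<epsilon> u\<close> is constant on the connected complement of the plate, and it
  vanishes near the midpoint of the plate; this leaves
  \<open>\<bar>u p\<bar> \<le> \<epsilon>\<close>.\<close>

theorem flux_eq_0:
  assumes "p \<notin> closed_segment a b"
  shows "u p = 0"
proof -
  have "\<bar>u p\<bar> \<le> \<epsilon>" if \<epsilon>: "0 < \<epsilon>" for \<epsilon>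
  proof -
    have "GDERIV (\<lambda>q. soft \<epsilon> (u q)) q :> (2 * excess \<epsilon> (u q)) *\<^sub>R U q" if "q \<in> \<Omega>" for q
      using that by (intro GDERIV_DERIV_compose[OF grad soft_deriv[OF \<epsilon>]]) auto
    moreover have "(2 * excess \<epsilon> (u q)) *\<^sub>R U q = 0" if "q \<in> \<Omega>" for q
      using excess_mult_gradient_eq_0[of q \<epsilon>] that \<epsilon> by auto
    ultimately have der: "((\<lambda>q. soft \<epsilon> (u q)) has_derivative (\<lambda>_. 0)) (at q)" if "q \<in> \<Omega>" for q
      using that by (fastforce simp: gderiv_def)
    have "path_connected \<Omega>"
      by (rule path_connected_complement_bounded_convex) (auto simp: bounded_closed_segment)
    then have conn: "connected \<Omega>" by (rule path_connected_imp_connected)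
    have m: "midpoint a b \<in> open_segment a b"
      using ab by simp
    from vanishes_near[OF this \<epsilon>] obtain e where e: "e > 0"
      "\<forall>q\<in>ball (midpoint a b) e - closed_segment a b. \<bar>u q\<bar> < \<epsilon>" by blast
    \<comment> \<open>Supplies a point off the plate that is close to the midpoint.\<close>
    have "interior (closed_segment a b) = {}"
      by (rule interior_closed_segment_ge2) simp
    then have "\<not> ball (midpoint a b) e \<subseteq> closed_segment a b"
      using e interior_maximal[of "ball (midpoint a b) e" "closed_segment a b"] by auto
    then obtain q where q: "q \<in> ball (midpoint a b) e - closed_segment a b" by blast
    have "soft \<epsilon> (u p) = soft \<epsilon> (u q)"
      by (rule has_derivative_zero_unique_connected[OF _ conn der])
        (use assms q in \<open>auto simp: open_Compl\<close>)
    also have "soft \<epsilon> (u q) = 0"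
      using abs_soft[OF \<epsilon>, of "u q"] excess_bounds(3)[of "u q" \<epsilon>] e q by auto
    finally have "excess \<epsilon> (u p) = 0" using abs_soft[OF \<epsilon>, of "u p"] by simp
    then show ?thesis by (auto simp: excess_def max_def split: if_splits)
  qed
  then show ?thesis using field_le_epsilon[of "\<bar>u p\<bar>" 0] by simp
qed

end

section \<open>Second derivatives and the slip condition\<close>

text \<open>
  The symmetry of second derivatives, assuming only that the first derivatives are differentiable
  at the point: both mixed derivatives are limits of the same second difference quotient.
\<close>

lemma second_difference:
  fixes f A :: "real \<Rightarrow> real \<Rightarrow> real"
  assumes r: "0 < r"
    and der: "\<And>s t. \<bar>s - x\<bar> < r \<Longrightarrow> \<bar>t - y\<bar> < r \<Longrightarrow> ((\<lambda>s. f s t) has_real_derivative A s t) (at s)"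
    and A: "\<And>e. 0 < e \<Longrightarrow> \<exists>d>0. \<forall>s t. \<bar>s\<bar> < d \<longrightarrow> \<bar>t\<bar> < d \<longrightarrow>
      \<bar>A (x + s) (y + t) - A x y - s * D1 - t * D2\<bar> \<le> e * (\<bar>s\<bar> + \<bar>t\<bar>)"
  shows "((\<lambda>h. (f (x + h) (y + h) - f (x + h) y - f x (y + h) + f x y) / h\<^sup>2) \<longlongrightarrow> D2) (at_right 0)"
proof (rule tendstoI)
  fix e :: real assume e: "0 < e"
  \<comment> \<open>After the mean value theorem in \<open>s\<close>, both values of
    \<open>A\<close> are expanded about \<open>(x, y)\<close> and the \<open>D1\<close> terms
    cancel. The errors are at most \<open>2 * h\<close> and \<open>h\<close> times
    \<open>e / 4\<close>, in total less than \<open>e * h\<close>.\<close>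
  then have "0 < e / 4" by simp
  from A[OF this] obtain d where d: "0 < d" "\<And>s t. \<bar>s\<bar> < d \<Longrightarrow> \<bar>t\<bar> < d \<Longrightarrow>
      \<bar>A (x + s) (y + t) - A x y - s * D1 - t * D2\<bar> \<le> e / 4 * (\<bar>s\<bar> + \<bar>t\<bar>)" by blast
  have "dist ((f (x + h) (y + h) - f (x + h) y - f x (y + h) + f x y) / h\<^sup>2) D2 < e"
    if h: "0 < h" "h < min r d" for h
  proof -
    have "\<exists>z>x. z < x + h \<and> (\<lambda>s. f s (y + h) - f s y) (x + h) - (\<lambda>s. f s (y + h) - f s y) x
      = (x + h - x) * (\<lambda>s. A s (y + h) - A s y) z"
      by (rule MVT2) (use h in \<open>auto intro!: DERIV_diff der\<close>)
    then obtain z where z: "x < z" "z < x + h"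
      "f (x + h) (y + h) - f (x + h) y - f x (y + h) + f x y = h * (A z (y + h) - A z y)"
      by (auto simp: algebra_simps)
    let ?s = "z - x"
    have 1: "\<bar>A z (y + h) - A x y - ?s * D1 - h * D2\<bar> \<le> e / 4 * (\<bar>?s\<bar> + \<bar>h\<bar>)"
      using d(2)[of ?s h] z h by simp
    have 2: "\<bar>A z y - A x y - ?s * D1\<bar> \<le> e / 4 * \<bar>?s\<bar>"
      using d(2)[of ?s 0] z h by simp
    have "\<bar>(A z (y + h) - A z y) - h * D2\<bar> \<le> e / 4 * (\<bar>?s\<bar> + \<bar>h\<bar>) + e / 4 * \<bar>?s\<bar>"
      using 1 2 by linarith
    also have "\<dots> \<le> e / 4 * (h + h) + e / 4 * h"
      using z h e by (intro add_mono mult_left_mono) auto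
    finally have "\<bar>(A z (y + h) - A z y) - h * D2\<bar> \<le> 3 * e / 4 * h" by (simp add: algebra_simps)
    then have "\<bar>(A z (y + h) - A z y) - h * D2\<bar> / h \<le> 3 * e / 4"
      using h by (simp add: field_simps)
    moreover have "\<bar>(A z (y + h) - A z y) - h * D2\<bar> / h = \<bar>(A z (y + h) - A z y) / h - D2\<bar>"
    proof -
      have "(A z (y + h) - A z y) / h - D2 = (A z (y + h) - A z y - h * D2) / h"
        using h by (simp add: field_simps)
      then show ?thesis using h by simp
    qed
    moreover have "(f (x + h) (y + h) - f (x + h) y - f x (y + h) + f x y) / h\<^sup>2 = (A z (y + h) - A z y) / h"
      using h unfolding z(3) by (simp add: power2_eq_square)
    ultimately show ?thesis using e by (simp add: dist_real_def)
  qed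
  then show "eventually (\<lambda>h. dist ((f (x + h) (y + h) - f (x + h) y - f x (y + h) + f x y) / h\<^sup>2) D2 < e) (at_right 0)"
    using r d by (intro eventually_at_rightI[of 0 "min r d"]) auto
qed

lemma GDERIV_increment:
  fixes A :: "plane \<Rightarrow> real"
  assumes "GDERIV A (x, y) :> D" and "0 < e"
  shows "\<exists>d>0. \<forall>s t. \<bar>s\<bar> < d \<longrightarrow> \<bar>t\<bar> < d \<longrightarrow>
      \<bar>A (x + s, y + t) - A (x, y) - s * fst D - t * snd D\<bar> \<le> e * (\<bar>s\<bar> + \<bar>t\<bar>)"
proof -
  from assms obtain d where d: "d > 0" "\<And>q. norm (q - (x, y)) < d \<Longrightarrow>
      norm (A q - A (x, y) - (q - (x, y)) \<bullet> D) \<le> e * norm (q - (x, y))"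
    unfolding gderiv_def has_derivative_at_alt by blast
  have "\<bar>A (x + s, y + t) - A (x, y) - s * fst D - t * snd D\<bar> \<le> e * (\<bar>s\<bar> + \<bar>t\<bar>)"
    if st: "\<bar>s\<bar> < d / 2" "\<bar>t\<bar> < d / 2" for s t
  proof -
    have n: "norm (s, t) \<le> \<bar>s\<bar> + \<bar>t\<bar>" using norm_Pair_le[of s t] by simp
    then have "norm (s, t) < d" using st by linarith
    with d(2)[of "(x + s, y + t)"]
    have "\<bar>A (x + s, y + t) - A (x, y) - s * fst D - t * snd D\<bar> \<le> e * norm (s, t)"
      by (simp add: inner_prod_def algebra_simps)
    also have "\<dots> \<le> e * (\<bar>s\<bar> + \<bar>t\<bar>)" using n assms by (intro mult_left_mono) auto
    finally show ?thesis .
  qed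
  with d(1) show ?thesis by (intro exI[of _ "d / 2"]) auto
qed

lemma pdy_pdx_commute:
  fixes f :: "plane \<Rightarrow> real"
  assumes S: "open S" "p \<in> S" and f: "\<And>q. q \<in> S \<Longrightarrow> f differentiable (at q)"
    and fx: "pdx f differentiable (at p)" and fy: "pdy f differentiable (at p)"
  shows "pdy (pdx f) p = pdx (pdy f) p"
proof -
  obtain x y where p: "p = (x, y)" by (cases p)
  from S obtain r where r: "r > 0" "ball p r \<subseteq> S" by (auto simp: open_contains_ball)
  have near: "(s, t) \<in> S" if "\<bar>s - x\<bar> < r / 2" "\<bar>t - y\<bar> < r / 2" for s t
  proof -
    have "norm (s - x, t - y) \<le> \<bar>s - x\<bar> + \<bar>t - y\<bar>" using norm_Pair_le[of "s - x" "t - y"] by simp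
    then have "norm ((s, t) - p) < r" using that unfolding p by simp
    with r show ?thesis by (auto simp: dist_norm norm_minus_commute)
  qed
  have "((\<lambda>h. (f (x + h, y + h) - f (x + h, y) - f (x, y + h) + f (x, y)) / h\<^sup>2) \<longlongrightarrow> pdy (pdx f) p) (at_right 0)"
  proof (rule second_difference[where f="\<lambda>s t. f (s, t)" and A="\<lambda>s t. pdx f (s, t)" and r="r / 2"])
    show "((\<lambda>s. f (s, t)) has_real_derivative pdx f (s, t)) (at s)"
      if "\<bar>s - x\<bar> < r / 2" "\<bar>t - y\<bar> < r / 2" for s t
      using GDERIV_pdx[OF differentiable_GDERIV[OF f[OF near[OF that]]]] by simp
    show "\<exists>d>0. \<forall>s t. \<bar>s\<bar> < d \<longrightarrow> \<bar>t\<bar> < d \<longrightarrow>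
      \<bar>pdx f (x + s, y + t) - pdx f (x, y) - s * pdx (pdx f) p - t * pdy (pdx f) p\<bar> \<le> e * (\<bar>s\<bar> + \<bar>t\<bar>)"
      if "0 < e" for e
      using GDERIV_increment[OF differentiable_GDERIV[OF fx, unfolded p] that] unfolding p fst_conv snd_conv .
  qed (use r in simp)
  \<comment> \<open>The same second difference with the two variables exchanged.\<close>
  moreover have "((\<lambda>h. (f (x + h, y + h) - f (x, y + h) - f (x + h, y) + f (x, y)) / h\<^sup>2) \<longlongrightarrow> pdx (pdy f) p) (at_right 0)"
  proof (rule second_difference[where f="\<lambda>t s. f (s, t)" and A="\<lambda>t s. pdy f (s, t)" and r="r / 2"])
    show "((\<lambda>t. f (s, t)) has_real_derivative pdy f (s, t)) (at t)"
      if "\<bar>t - y\<bar> < r / 2" "\<bar>s - x\<bar> < r / 2" for s t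
      using GDERIV_pdy[OF differentiable_GDERIV[OF f[OF near[OF that(2,1)]]]] by simp
    fix e :: real assume "0 < e"
    from GDERIV_increment[OF differentiable_GDERIV[OF fy, unfolded p] this] obtain d where d: "d > 0"
      "\<And>s t. \<bar>s\<bar> < d \<Longrightarrow> \<bar>t\<bar> < d \<Longrightarrow>
        \<bar>pdy f (x + s, y + t) - pdy f (x, y) - s * pdx (pdy f) p - t * pdy (pdy f) p\<bar> \<le> e * (\<bar>s\<bar> + \<bar>t\<bar>)"
      unfolding p fst_conv snd_conv by blast
    have "\<bar>pdy f (x + t, y + s) - pdy f (x, y) - s * pdy (pdy f) p - t * pdx (pdy f) p\<bar> \<le> e * (\<bar>s\<bar> + \<bar>t\<bar>)"
      if "\<bar>s\<bar> < d" "\<bar>t\<bar> < d" for s t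
      using d(2)[OF that(2,1)] by (simp only: diff_right_commute add.commute[of "\<bar>t\<bar>"])
    with d(1) show "\<exists>d>0. \<forall>s t. \<bar>s\<bar> < d \<longrightarrow> \<bar>t\<bar> < d \<longrightarrow>
      \<bar>pdy f (x + t, y + s) - pdy f (x, y) - s * pdy (pdy f) p - t * pdx (pdy f) p\<bar> \<le> e * (\<bar>s\<bar> + \<bar>t\<bar>)"
      by blast
  qed (use r in simp)
  moreover have "f (x + h, y + h) - f (x, y + h) - f (x + h, y) + f (x, y)
      = f (x + h, y + h) - f (x + h, y) - f (x, y + h) + f (x, y)" for h
    by simp
  ultimately show ?thesis
    by (intro tendsto_unique[of "at_right (0::real)"]) simp_all
qed

lemma pd_cong_open:
  assumes "open S" "p \<in> S" "\<And>q. q \<in> S \<Longrightarrow> f q = g q"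
  shows "pdx f p = pdx g p" "pdy f p = pdy g p"
proof -
  have "open ((\<lambda>x. (x, snd p)) -` S)" "open ((\<lambda>y. (fst p, y)) -` S)"
    by (intro continuous_open_vimage assms; auto intro!: continuous_intros)+
  then have "eventually (\<lambda>x. (x, snd p) \<in> S) (nhds (fst p))" "eventually (\<lambda>y. (fst p, y) \<in> S) (nhds (snd p))"
    using assms(2) eventually_nhds_in_open[of "(\<lambda>x. (x, snd p)) -` S" "fst p"]
      eventually_nhds_in_open[of "(\<lambda>y. (fst p, y)) -` S" "snd p"] by simp_all
  then show "pdx f p = pdx g p" "pdy f p = pdy g p"
    unfolding pdx_def pdy_def
    by (auto intro!: deriv_cong_ev assms(3) elim: eventually_mono)
qed

lemma differentiable_cong_open:
  fixes f g :: "'a::real_normed_vector \<Rightarrow> 'b::real_normed_vector"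
  assumes "open S" "p \<in> S" "\<And>q. q \<in> S \<Longrightarrow> f q = g q" "g differentiable (at p)"
  shows "f differentiable (at p)"
  using assms has_derivative_transform_within_open[of g _ p UNIV S f]
  unfolding differentiable_def by metis

section \<open>Geometry of the plate and the slip condition\<close>

text \<open>A quarter turn of \<open>b - a\<close> that points into \<open>plate_side a b\<close>;
  it is not normalised, hence the squared length in \<open>normal_decomposition\<close>.\<close>

definition normal :: "plane \<Rightarrow> plane \<Rightarrow> plane" where
  "normal a b = (- snd (b - a), fst (b - a))"

lemma normal_swap: "normal b a = - normal a b"
  by (simp add: normal_def)

lemma plate_side_normal: "plate_side a b = {p. 0 < (p - a) \<bullet> normal a b}"
  by (simp add: plate_side_def normal_def)

lemma normal_orthogonal: "(b - a) \<bullet> normal a b = 0"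
  by (simp add: normal_def inner_prod_def algebra_simps)

lemma normal_decomposition:
  "(norm (b - a))\<^sup>2 *\<^sub>R z = (z \<bullet> (b - a)) *\<^sub>R (b - a) + (z \<bullet> normal a b) *\<^sub>R normal a b"
  by (cases z; cases a; cases b)
    (simp add: normal_def inner_prod_def power2_norm_eq_inner algebra_simps)

lemma norm_normal: "norm (normal a b) = norm (b - a)"
  by (simp add: normal_def norm_prod_def add.commute power2_commute)

lemma closed_segment_normal:
  assumes "q \<in> closed_segment a b"
  shows "(q - a) \<bullet> normal a b = 0"
proof -
  from assms obtain u where "q = (1 - u) *\<^sub>R a + u *\<^sub>R b" by (auto simp: in_segment)
  then have "q - a = u *\<^sub>R (b - a)" by (simp add: algebra_simps)
  then show ?thesis by (simp add: normal_orthogonal)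
qed

text \<open>A point in neither half-plane lies on the line through the plate, and if it is closer to
  \<open>p\<close> than both tips are, it lies on the plate. The radius chosen is the distance from
  \<open>p\<close> to the nearer tip.\<close>

lemma plate_sides_cover:
  assumes "p \<in> open_segment a b"
  shows "\<exists>e>0. ball p e - closed_segment a b \<subseteq> plate_side a b \<union> plate_side b a"
proof -
  from assms obtain t where t: "0 < t" "t < 1" "p = (1 - t) *\<^sub>R a + t *\<^sub>R b" and ab: "a \<noteq> b"
    by (auto simp: in_segment)
  let ?e = "min t (1 - t) * norm (b - a)"
  have "q \<in> closed_segment a b" if q: "q \<in> ball p ?e" "(q - a) \<bullet> normal a b = 0" for q
  proof -
    let ?L = "(norm (b - a))\<^sup>2"
    have L: "?L > 0" using ab by simp
    define s where "s = (q - a) \<bullet> (b - a) / ?L"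
    have "?L *\<^sub>R (q - a) = ((q - a) \<bullet> (b - a)) *\<^sub>R (b - a)"
      using normal_decomposition[of b a "q - a"] q by simp
    then have "(1 / ?L) *\<^sub>R ?L *\<^sub>R (q - a) = (1 / ?L) *\<^sub>R ((q - a) \<bullet> (b - a)) *\<^sub>R (b - a)" by simp
    then have qs: "q - a = s *\<^sub>R (b - a)" using L ab by (simp add: s_def)
    have qp: "q - p = (s - t) *\<^sub>R (b - a)"
      using qs unfolding t(3) by (simp add: algebra_simps)
    have "norm (q - p) < ?e"
      using q(1) unfolding mem_ball dist_norm norm_minus_commute[of p q] .
    then have "\<bar>s - t\<bar> * norm (b - a) < ?e"
      unfolding qp by simp
    then have "\<bar>s - t\<bar> < min t (1 - t)" using ab by (simp add: mult_less_cancel_right)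
    then have "0 \<le> s" "s \<le> 1" by auto
    moreover have "q = (1 - s) *\<^sub>R a + s *\<^sub>R b" using qs by (simp add: algebra_simps)
    ultimately show ?thesis by (auto simp: in_segment)
  qed
  moreover have "(q - b) \<bullet> normal b a = - ((q - a) \<bullet> normal a b)" for q
    using normal_orthogonal[of b a] by (simp add: normal_swap[of b a] inner_diff_left)
  ultimately have "ball p ?e - closed_segment a b \<subseteq> plate_side a b \<union> plate_side b a"
    unfolding plate_side_normal by fastforce
  moreover have "?e > 0" using t ab by simp
  ultimately show ?thesis by blast
qed

lemma plate_side_disjoint: "q \<in> plate_side a b \<Longrightarrow> q \<notin> closed_segment a b"
  using closed_segment_normal[of q a b] by (auto simp: plate_side_normal)

text \<open>The tangential derivative has some limit \<open>L\<close>. If \<open>L\<close> were not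
  0, then along segments parallel to the plate at height \<open>h\<close> the change of
  \<open>\<psi>\<close> would stay bounded away from 0, although \<open>\<psi>\<close> tends to 0 at
  both ends as \<open>h\<close> decreases to 0.\<close>

lemma tangential_limit_one_side:
  fixes \<psi> :: "plane \<Rightarrow> real"
  assumes p: "p \<in> open_segment a b"
    and diff: "\<And>q. q \<in> plate_side a b \<Longrightarrow> \<psi> differentiable (at q)"
    and lx: "(pdx \<psi> \<longlongrightarrow> l1) (at p within plate_side a b)"
    and ly: "(pdy \<psi> \<longlongrightarrow> l2) (at p within plate_side a b)"
    and slip: "\<And>q. q \<in> open_segment a b \<Longrightarrow> (\<psi> \<longlongrightarrow> 0) (at q within - closed_segment a b)"
  shows "((\<lambda>q. (b - a) \<bullet> (pdx \<psi> q, pdy \<psi> q)) \<longlongrightarrow> 0) (at p within plate_side a b)"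
proof -
  let ?n = "normal a b" and ?H = "plate_side a b" and ?g = "\<lambda>q. (b - a) \<bullet> (pdx \<psi> q, pdy \<psi> q)"
  from p obtain t where t: "0 < t" "t < 1" "p = (1 - t) *\<^sub>R a + t *\<^sub>R b" and ab: "a \<noteq> b"
    by (auto simp: in_segment)
  have nn: "?n \<bullet> ?n > 0" using norm_normal[of a b] ab by (metis inner_gt_zero_iff norm_eq_zero right_minus_eq)
  have H: "p + s *\<^sub>R (b - a) + h *\<^sub>R ?n \<in> ?H" if "0 < h" for s h
  proof -
    have "p + s *\<^sub>R (b - a) + h *\<^sub>R ?n - a = (t + s) *\<^sub>R (b - a) + h *\<^sub>R ?n"
      unfolding t(3) by (simp add: algebra_simps)
    then show ?thesis
      using nn that unfolding plate_side_normal
      by (simp only: mem_Collect_eq inner_add_left inner_scaleR_left normal_orthogonal) simp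
  qed
  define L where "L = (b - a) \<bullet> (l1, l2)"
  have gL: "(?g \<longlongrightarrow> L) (at p within ?H)"
    unfolding L_def by (intro tendsto_intros lx ly)
  have "L = 0"
  proof (rule ccontr)
    assume "L \<noteq> 0"
    with gL obtain \<delta> where \<delta>: "\<delta> > 0" "\<And>q. q \<in> ?H \<Longrightarrow> 0 < dist q p \<Longrightarrow> dist q p < \<delta> \<Longrightarrow> dist (?g q) L < \<bar>L\<bar> / 2"
      unfolding Lim_within by (meson half_gt_zero zero_less_abs_iff)
    \<comment> \<open>Keeps \<open>p + s *\<^sub>R (b - a)\<close> on the open plate and uses up
      half of \<open>\<delta>\<close>; the other half is left for the height.\<close>
    define s where "s = min ((1 - t) / 2) (\<delta> / (2 * norm (b - a)))"
    have nab: "norm (b - a) > 0" using ab by simp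
    have s: "0 < s" "s < 1 - t" "s * norm (b - a) \<le> \<delta> / 2"
      using t \<delta> nab by (auto simp: s_def min_def field_simps)
    have ps: "p + s *\<^sub>R (b - a) \<in> open_segment a b"
      unfolding in_segment
      by (intro conjI ab exI[of _ "t + s"]) (use s t in \<open>auto simp: algebra_simps\<close>)
    have lim: "((\<lambda>h. \<psi> (q + h *\<^sub>R ?n)) \<longlongrightarrow> 0) (at_right 0)" if q: "q \<in> open_segment a b"
      and qH: "\<And>h. 0 < h \<Longrightarrow> q + h *\<^sub>R ?n \<in> ?H" for q
    proof (rule filterlim_compose[OF slip[OF q]])
      have "((\<lambda>h. q + h *\<^sub>R ?n) \<longlongrightarrow> q + 0 *\<^sub>R ?n) (at_right 0)"
        by (intro tendsto_intros)
      moreover have "q \<in> closed_segment a b" using q by (simp add: open_segment_def)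
      ultimately show "filterlim (\<lambda>h. q + h *\<^sub>R ?n) (at q within - closed_segment a b) (at_right 0)"
        unfolding filterlim_at using plate_side_disjoint[OF qH]
        by (auto intro!: eventually_at_rightI[of 0 1])
    qed
    have "((\<lambda>h. \<bar>\<psi> (p + s *\<^sub>R (b - a) + h *\<^sub>R ?n) - \<psi> (p + h *\<^sub>R ?n)\<bar>) \<longlongrightarrow> \<bar>0 - 0\<bar>) (at_right 0)"
      using H[of _ s] H[of _ 0] by (intro tendsto_intros lim ps p) auto
    moreover have "s * (\<bar>L\<bar> / 2) \<le> \<bar>\<psi> (p + s *\<^sub>R (b - a) + h *\<^sub>R ?n) - \<psi> (p + h *\<^sub>R ?n)\<bar>"
      if h: "0 < h" "h < \<delta> / (2 * norm (b - a))" for h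
    proof -
      let ?q = "\<lambda>\<theta>. p + \<theta> *\<^sub>R (b - a) + h *\<^sub>R ?n"
      have "((\<lambda>\<theta>. \<psi> (?q \<theta>)) has_real_derivative ?g (?q \<theta>)) (at \<theta>)" for \<theta>
      proof -
        have "(?q has_derivative (\<lambda>k. k *\<^sub>R (b - a))) (at \<theta>)"
          by (auto intro!: derivative_eq_intros)
        from diff_chain_at[OF this differentiable_GDERIV[OF diff[OF H[OF h(1)]], unfolded gderiv_def]]
        show ?thesis by (simp add: o_def has_field_derivative_def mult_commute_abs)
      qed
      then obtain \<xi> where \<xi>: "0 < \<xi>" "\<xi> < s" "\<psi> (?q s) - \<psi> (?q 0) = (s - 0) * ?g (?q \<xi>)"
        using MVT2[OF s(1), of "\<lambda>\<theta>. \<psi> (?q \<theta>)" "\<lambda>\<theta>. ?g (?q \<theta>)"] by blast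
      have "dist (?q \<xi>) p \<le> \<xi> * norm (b - a) + h * norm (b - a)"
      proof -
        have "?q \<xi> - p = \<xi> *\<^sub>R (b - a) + h *\<^sub>R ?n" by simp
        then show ?thesis
          using norm_triangle_ineq[of "\<xi> *\<^sub>R (b - a)" "h *\<^sub>R ?n"] \<xi> h
          unfolding dist_norm by (simp add: norm_normal del: add_diff_cancel_left)
      qed
      also have "\<dots> < s * norm (b - a) + \<delta> / 2"
        using \<xi> h nab by (intro add_strict_mono) (auto simp: field_simps)
      also have "\<dots> \<le> \<delta>" using s by simp
      finally have "dist (?q \<xi>) p < \<delta>" .
      moreover have "?q \<xi> \<noteq> p"
        using plate_side_disjoint[OF H[OF h(1), of \<xi>]] p unfolding open_segment_def by (metis DiffD1)
      ultimately have "dist (?g (?q \<xi>)) L < \<bar>L\<bar> / 2"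
        by (intro \<delta>(2) H h(1)) auto
      then have "\<bar>L\<bar> / 2 \<le> \<bar>?g (?q \<xi>)\<bar>" unfolding dist_real_def by linarith
      then have "s * (\<bar>L\<bar> / 2) \<le> s * \<bar>?g (?q \<xi>)\<bar>" using s by (intro mult_left_mono) auto
      then show ?thesis using \<xi>(3) s by (simp add: abs_mult)
    qed
    then have "eventually (\<lambda>h. s * (\<bar>L\<bar> / 2) \<le> \<bar>\<psi> (p + s *\<^sub>R (b - a) + h *\<^sub>R ?n) - \<psi> (p + h *\<^sub>R ?n)\<bar>) (at_right 0)"
      using \<delta> nab by (intro eventually_at_rightI[of 0 "\<delta> / (2 * norm (b - a))"]) auto
    ultimately have "s * (\<bar>L\<bar> / 2) \<le> \<bar>0 - 0\<bar>"
      by (intro tendsto_lowerbound) auto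
    moreover have "0 < s * (\<bar>L\<bar> / 2)" using s \<open>L \<noteq> 0\<close> by simp
    ultimately show False by simp
  qed
  with gL show ?thesis by simp
qed

text \<open>This is the slip condition for the momentum: the tangential derivative of
  \<open>\<psi>\<close> is minus its normal component. Both half-planes contribute the limit 0, and
  together they fill the complement of the plate near \<open>p\<close>.\<close>

lemma tangential_limit:
  fixes \<psi> :: "plane \<Rightarrow> real"
  assumes smooth: "smooth_up_to_plate a b \<psi>" and slip: "slip_condition (closed_segment a b) \<psi>"
    and p: "p \<in> open_segment a b"
  shows "((\<lambda>q. (b - a) \<bullet> (pdx \<psi> q, pdy \<psi> q)) \<longlongrightarrow> 0) (at p within - closed_segment a b)"
proof -
  have sm: "(pdx ^^ i) ((pdy ^^ j) \<psi>) differentiable (at q)" if "q \<notin> closed_segment a b" for i j q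
    using smooth that by (auto simp: smooth_up_to_plate_def smooth_on_def)
  have diff: "\<psi> differentiable (at q)" if "q \<notin> closed_segment a b" for q
    using sm[OF that, of 0 0] by simp
  have "interior (closed_segment a b) = {}" by (rule interior_closed_segment_ge2) simp
  then have fr: "frontier (closed_segment a b) = closed_segment a b"
    by (simp add: frontier_def closure_closed)
  have slip': "(\<psi> \<longlongrightarrow> 0) (at q within - closed_segment a b)" if "q \<in> open_segment a b" for q
    using slip that unfolding slip_condition_def fr by (auto simp: open_segment_def)
  have lim: "\<exists>l. ((pdx ^^ i) ((pdy ^^ j) \<psi>) \<longlongrightarrow> l) (at p within H)" if "H \<in> {plate_side a b, plate_side b a}" for i j H
    using smooth p that unfolding smooth_up_to_plate_def by blast
  have "((\<lambda>q. (b - a) \<bullet> (pdx \<psi> q, pdy \<psi> q)) \<longlongrightarrow> 0) (at p within plate_side a b)"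
  proof -
    obtain l1 l2 where "(pdx \<psi> \<longlongrightarrow> l1) (at p within plate_side a b)" "(pdy \<psi> \<longlongrightarrow> l2) (at p within plate_side a b)"
      using lim[of "plate_side a b" 1 0] lim[of "plate_side a b" 0 1] by auto
    then show ?thesis
      by (intro tangential_limit_one_side slip' p) (auto intro: diff dest: plate_side_disjoint)
  qed
  moreover have "((\<lambda>q. - ((a - b) \<bullet> (pdx \<psi> q, pdy \<psi> q))) \<longlongrightarrow> - 0) (at p within plate_side b a)"
  proof -
    obtain l1 l2 where "(pdx \<psi> \<longlongrightarrow> l1) (at p within plate_side b a)" "(pdy \<psi> \<longlongrightarrow> l2) (at p within plate_side b a)"
      using lim[of "plate_side b a" 1 0] lim[of "plate_side b a" 0 1] by auto
    then show ?thesis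
      using p slip' plate_side_disjoint[of _ b a]
      by (intro tendsto_minus tangential_limit_one_side)
        (auto intro: diff simp: open_segment_commute closed_segment_commute)
  qed
  moreover have "- ((a - b) \<bullet> z) = (b - a) \<bullet> z" for z :: plane
    by (simp add: inner_diff_left)
  ultimately have "((\<lambda>q. (b - a) \<bullet> (pdx \<psi> q, pdy \<psi> q)) \<longlongrightarrow> 0) (at p within plate_side a b \<union> plate_side b a)"
    unfolding Lim_within_Un by simp
  note lim' = this
  from plate_sides_cover[OF p] obtain e where e: "e > 0"
    "ball p e - closed_segment a b \<subseteq> plate_side a b \<union> plate_side b a" by blast
  from lim' this(2) have "((\<lambda>q. (b - a) \<bullet> (pdx \<psi> q, pdy \<psi> q)) \<longlongrightarrow> 0) (at p within ball p e - closed_segment a b)"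
    by (rule tendsto_within_subset)
  moreover have "at p within - closed_segment a b = at p within ball p e - closed_segment a b"
    by (rule at_within_nhd[of _ "ball p e"]) (use e in auto)
  ultimately show ?thesis by simp
qed

section \<open>Flows past the plate\<close>

text \<open>\<open>smooth_on\<close> lists only x-derivatives of y-derivatives; the three equations
  bring the other orders that occur in the divergence of \<open>W\<close> into this form.\<close>

lemma smooth_on_derivatives:
  assumes S: "open S" and sm: "smooth_on S \<psi>" and p: "p \<in> S"
  shows "pdx \<psi> differentiable (at p)" "pdy \<psi> differentiable (at p)"
    and "pdx (pdx \<psi>) differentiable (at p)" "pdx (pdy \<psi>) differentiable (at p)"
      "pdy (pdy \<psi>) differentiable (at p)"
    and "pdx (pdx (pdy \<psi>)) differentiable (at p)" "pdx (pdy (pdy \<psi>)) differentiable (at p)"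
    and "pdy (pdx \<psi>) p = pdx (pdy \<psi>) p"
    and "pdy (pdx (pdx \<psi>)) p = pdx (pdx (pdy \<psi>)) p"
    and "pdy (pdx (pdy \<psi>)) p = pdx (pdy (pdy \<psi>)) p"
proof -
  have D: "(pdx ^^ i) ((pdy ^^ j) \<psi>) differentiable (at q)" if "q \<in> S" for i j q
    using sm that unfolding smooth_on_def by blast
  have d: "\<psi> differentiable (at q)" "pdx \<psi> differentiable (at q)" "pdy \<psi> differentiable (at q)"
    "pdx (pdx \<psi>) differentiable (at q)" "pdx (pdy \<psi>) differentiable (at q)"
    "pdy (pdy \<psi>) differentiable (at q)"
    "pdx (pdx (pdy \<psi>)) differentiable (at q)" "pdx (pdy (pdy \<psi>)) differentiable (at q)" if "q \<in> S" for q
    using D[OF that, of 0 0] D[OF that, of 1 0] D[OF that, of 0 1] D[OF that, of 2 0]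
      D[OF that, of 1 1] D[OF that, of 0 2] D[OF that, of 2 1] D[OF that, of 1 2]
    by (simp_all add: numeral_2_eq_2)
  show "pdx \<psi> differentiable (at p)" "pdy \<psi> differentiable (at p)"
    "pdx (pdx \<psi>) differentiable (at p)" "pdx (pdy \<psi>) differentiable (at p)"
    "pdy (pdy \<psi>) differentiable (at p)"
    "pdx (pdx (pdy \<psi>)) differentiable (at p)" "pdx (pdy (pdy \<psi>)) differentiable (at p)"
    using d[OF p] by auto
  have xy: "pdy (pdx \<psi>) q = pdx (pdy \<psi>) q" if "q \<in> S" for q
    using S that d by (intro pdy_pdx_commute) auto
  show "pdy (pdx \<psi>) p = pdx (pdy \<psi>) p" by (rule xy[OF p])
  show "pdy (pdx (pdy \<psi>)) p = pdx (pdy (pdy \<psi>)) p"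
    using S p d by (intro pdy_pdx_commute) auto
  \<comment> \<open>Differentiability of \<open>pdy (pdx \<psi>)\<close> is carried over from
    \<open>pdx (pdy \<psi>)\<close>, which agrees with it on \<open>S\<close>.\<close>
  have "pdy (pdx (pdx \<psi>)) p = pdx (pdy (pdx \<psi>)) p"
    using S p d differentiable_cong_open[OF S p xy] by (intro pdy_pdx_commute) auto
  also have "\<dots> = pdx (pdx (pdy \<psi>)) p" by (rule pd_cong_open(1)[OF S p xy])
  finally show "pdy (pdx (pdx \<psi>)) p = pdx (pdx (pdy \<psi>)) p" .
qed

definition directional :: "plane \<Rightarrow> (plane \<Rightarrow> plane) \<Rightarrow> plane \<Rightarrow> plane" where
  "directional n v p =
     (n \<bullet> (pdx (\<lambda>q. fst (v q)) p, pdy (\<lambda>q. fst (v q)) p),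
      n \<bullet> (pdx (\<lambda>q. snd (v q)) p, pdy (\<lambda>q. snd (v q)) p))"

lemma directional_cong_open:
  assumes "open S" "p \<in> S" "\<And>q. q \<in> S \<Longrightarrow> v q = w q"
  shows "directional n v p = directional n w p"
  using pd_cong_open[OF assms(1,2), of "\<lambda>q. fst (v q)" "\<lambda>q. fst (w q)"]
    pd_cong_open[OF assms(1,2), of "\<lambda>q. snd (v q)" "\<lambda>q. snd (w q)"] assms(3)
  by (simp add: directional_def)

lemma pd_uminus: "pdx (\<lambda>q. - f q) p = - pdx f p" "pdy (\<lambda>q. - f q) p = - pdy f p"
  if "f differentiable (at p)"
proof -
  have "GDERIV (\<lambda>q. - f q) p :> - (pdx f p, pdy f p)"
    by (rule GDERIV_minus[OF differentiable_GDERIV[OF that]])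
  from GDERIV_pd[OF this] show "pdx (\<lambda>q. - f q) p = - pdx f p" "pdy (\<lambda>q. - f q) p = - pdy f p"
    by simp_all
qed

lemma differentiable_components:
  fixes v :: "plane \<Rightarrow> plane"
  assumes "v differentiable (at p)"
  shows "GDERIV (\<lambda>q. fst (v q)) p :> (pdx (\<lambda>q. fst (v q)) p, pdy (\<lambda>q. fst (v q)) p)"
    and "GDERIV (\<lambda>q. snd (v q)) p :> (pdx (\<lambda>q. snd (v q)) p, pdy (\<lambda>q. snd (v q)) p)"
proof -
  from assms obtain D where "(v has_derivative D) (at p)" by (auto simp: differentiable_def)
  then have "(\<lambda>q. fst (v q)) differentiable (at p)" "(\<lambda>q. snd (v q)) differentiable (at p)"
    using has_derivative_fst has_derivative_snd unfolding differentiable_def by blast+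
  then show "GDERIV (\<lambda>q. fst (v q)) p :> (pdx (\<lambda>q. fst (v q)) p, pdy (\<lambda>q. fst (v q)) p)"
    "GDERIV (\<lambda>q. snd (v q)) p :> (pdx (\<lambda>q. snd (v q)) p, pdy (\<lambda>q. snd (v q)) p)"
    by (auto intro: differentiable_GDERIV)
qed

text \<open>The gradient of \<open>n \<bullet> v\<close> is the transposed Jacobian applied to
  \<open>n\<close>; vanishing curl makes the Jacobian symmetric.\<close>

lemma curl_free_gradient:
  fixes v :: "plane \<Rightarrow> plane"
  assumes v: "v differentiable (at p)"
    and curl: "pdx (\<lambda>q. snd (v q)) p - pdy (\<lambda>q. fst (v q)) p = 0"
  shows "GDERIV (\<lambda>q. n \<bullet> v q) p :> directional n v p"
proof -
  let ?x = "(pdx (\<lambda>q. fst (v q)) p, pdy (\<lambda>q. fst (v q)) p)"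
  let ?y = "(pdx (\<lambda>q. snd (v q)) p, pdy (\<lambda>q. snd (v q)) p)"
  have "GDERIV (\<lambda>q. fst n * fst (v q) + snd n * snd (v q)) p :> fst n *\<^sub>R ?x + snd n *\<^sub>R ?y"
    using GDERIV_add[OF GDERIV_mult[OF GDERIV_const[of "fst n"] differentiable_components(1)[OF v]]
      GDERIV_mult[OF GDERIV_const[of "snd n"] differentiable_components(2)[OF v]]]
    by simp
  moreover have "fst n *\<^sub>R ?x + snd n *\<^sub>R ?y = directional n v p"
    using curl by (simp add: directional_def inner_prod_def)
  ultimately show ?thesis by (simp add: inner_prod_def)
qed

lemma tangential_flow_eq_0:
  fixes v :: "plane \<Rightarrow> plane"
  assumes ab: "snd a \<noteq> snd b"
    and v: "\<And>p. p \<notin> closed_segment a b \<Longrightarrow> v differentiable (at p)"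
    and curl: "\<And>p. p \<notin> closed_segment a b \<Longrightarrow> pdx (\<lambda>q. snd (v q)) p - pdy (\<lambda>q. fst (v q)) p = 0"
    and inf: "horizontal_at_infinity v"
    and tang: "\<And>p. p \<notin> closed_segment a b \<Longrightarrow> normal a b \<bullet> v p = 0"
    and p: "p \<notin> closed_segment a b"
  shows "v p = 0"
proof -
  let ?n = "normal a b"
  from ab have n1: "fst ?n \<noteq> 0" and ne: "a \<noteq> b" by (auto simp: normal_def)
  then have n0: "?n \<noteq> 0" by auto
  \<comment> \<open>The sign makes the ray lead away from the line through the plate, so it never
    meets the plate.\<close>
  define \<sigma> :: real where "\<sigma> = (if 0 \<le> (p - a) \<bullet> ?n then 1 else - 1)"
  let ?q = "\<lambda>h::real. p + h *\<^sub>R (\<sigma> *\<^sub>R ?n)"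
  have ray: "?q h \<notin> closed_segment a b" if "0 \<le> h" for h
  proof (cases "h = 0")
    case False
    have "(?q h - a) \<bullet> ?n = (p - a) \<bullet> ?n + h * \<sigma> * (?n \<bullet> ?n)"
      by (simp add: inner_add_left inner_diff_left)
    moreover have "0 < h * (?n \<bullet> ?n)" using that False n0 by simp
    ultimately have "(?q h - a) \<bullet> ?n \<noteq> 0" by (auto simp: \<sigma>_def)
    then show ?thesis using closed_segment_normal[of "?q h" a b] by blast
  qed (use p in simp)
  have far: "filterlim ?q at_infinity at_top"
  proof (rule filterlim_norm_at_top_imp_at_infinity, rule filterlim_at_top_mono)
    show "filterlim (\<lambda>h. - norm p + norm ?n * h) at_top at_top"
      using n0 by (intro filterlim_tendsto_add_at_top[OF tendsto_const]
          filterlim_tendsto_pos_mult_at_top[OF tendsto_const] filterlim_ident) auto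
    have "- norm p + norm ?n * h \<le> norm (?q h)" if "0 \<le> h" for h
      using norm_triangle_ineq2[of "h *\<^sub>R (\<sigma> *\<^sub>R ?n)" "- p"] that
      by (cases "0 \<le> (p - a) \<bullet> ?n") (simp_all add: \<sigma>_def mult.commute add.commute)
    then show "eventually (\<lambda>h. - norm p + norm ?n * h \<le> norm (?q h)) at_top"
      by (rule eventually_at_top_linorderI[of 0])
  qed
  from inf obtain vx where vinf: "(v \<longlongrightarrow> (vx, 0)) at_infinity"
    unfolding horizontal_at_infinity_def by blast
  have lim: "((\<lambda>h. z \<bullet> v (?q h)) \<longlongrightarrow> z \<bullet> (vx, 0)) at_top" for z
    by (intro tendsto_intros filterlim_compose[OF vinf far])
  have "((\<lambda>h. ?n \<bullet> v (?q h)) \<longlongrightarrow> 0) at_top"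
    by (rule tendsto_eventually, rule eventually_at_top_linorderI[of 0]) (rule tang[OF ray])
  with lim[of ?n] have "?n \<bullet> (vx, 0) = 0" by (intro tendsto_unique) auto
  \<comment> \<open>The plate not being horizontal gives \<open>normal a b\<close> a nonzero first
    component.\<close>
  then have vx: "vx = 0" using n1 by (simp add: inner_prod_def)
  let ?t = "b - a"
  have D0: "directional ?n v q = 0" if "q \<notin> closed_segment a b" for q
  proof -
    have "GDERIV (\<lambda>q. ?n \<bullet> v q) q :> 0"
      using that by (intro GDERIV_locally_zero[of "- closed_segment a b"] tang) (auto simp: open_Compl)
    from GDERIV_pd[OF this] GDERIV_pd[OF curl_free_gradient[OF v curl, of q ?n]] that show ?thesis by simp
  qed
  have der: "((\<lambda>h. ?t \<bullet> v (?q h)) has_real_derivative 0) (at h)" if "0 \<le> h" for h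
  proof -
    let ?p = "?q h"
    have "(?q has_derivative (\<lambda>k. k *\<^sub>R (\<sigma> *\<^sub>R ?n))) (at h)"
      by (auto intro!: derivative_eq_intros)
    from diff_chain_at[OF this curl_free_gradient[OF v[OF ray[OF that]] curl[OF ray[OF that]], of ?t, unfolded gderiv_def]]
    have "((\<lambda>h. ?t \<bullet> v (?q h)) has_real_derivative \<sigma> * (?n \<bullet> directional ?t v ?p)) (at h)"
      by (simp add: o_def has_field_derivative_def mult_commute_abs mult.assoc)
    \<comment> \<open>Symmetry of the Jacobian once more, so that \<open>D0\<close> applies.\<close>
    moreover have "?n \<bullet> directional ?t v ?p = ?t \<bullet> directional ?n v ?p"
      using curl[OF ray[OF that]] by (simp add: directional_def inner_prod_def algebra_simps)
    ultimately show ?thesis using D0[OF ray[OF that]] by simp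
  qed
  have const: "?t \<bullet> v (?q h) = ?t \<bullet> v (?q 0)" if "0 \<le> h" for h
  proof (cases "h = 0")
    case False
    with that have "0 < h" by simp
    from MVT2[OF this, of "\<lambda>h. ?t \<bullet> v (?q h)" "\<lambda>_. 0"] der show ?thesis by auto
  qed simp
  have "((\<lambda>h. ?t \<bullet> v (?q h)) \<longlongrightarrow> ?t \<bullet> v p) at_top"
    by (rule tendsto_eventually) (use const in \<open>auto intro!: eventually_at_top_linorderI[of 0]\<close>)
  with lim[of ?t] vx have "?t \<bullet> v p = 0" by (intro tendsto_unique) (auto simp flip: zero_prod_def)
  with tang[OF p] normal_decomposition[of b a "v p"] ne show ?thesis
    by (simp add: inner_commute)
qed

text \<open>The momentum is a rotated gradient of \<open>\<psi>\<close>, so its directional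
  derivative inherits the smoothness of \<open>\<psi>\<close>.\<close>

lemma directional_momentum:
  fixes \<psi> :: "plane \<Rightarrow> real"
  assumes S: "open S" and sm: "smooth_on S \<psi>"
  shows "q \<in> S \<Longrightarrow> directional n (\<lambda>q. (pdy \<psi> q, - pdx \<psi> q)) q
      = (n \<bullet> (pdx (pdy \<psi>) q, pdy (pdy \<psi>) q), - (n \<bullet> (pdx (pdx \<psi>) q, pdx (pdy \<psi>) q)))"
    and "continuous_on S (directional n (\<lambda>q. (pdy \<psi> q, - pdx \<psi> q)))"
proof -
  note sd = smooth_on_derivatives[OF S sm]
  let ?W = "\<lambda>q. (n \<bullet> (pdx (pdy \<psi>) q, pdy (pdy \<psi>) q), - (n \<bullet> (pdx (pdx \<psi>) q, pdx (pdy \<psi>) q)))"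
  have W: "directional n (\<lambda>q. (pdy \<psi> q, - pdx \<psi> q)) q = ?W q" if "q \<in> S" for q
    using sd[OF that] by (simp add: directional_def pd_uminus inner_prod_def)
  show "q \<in> S \<Longrightarrow> directional n (\<lambda>q. (pdy \<psi> q, - pdx \<psi> q)) q = ?W q" by (rule W)
  have cont: "continuous_on S f" if "\<And>q. q \<in> S \<Longrightarrow> f differentiable (at q)" for f :: "plane \<Rightarrow> real"
    using that by (auto intro!: continuous_at_imp_continuous_on differentiable_imp_continuous_within)
  have "continuous_on S ?W" by (intro continuous_intros cont sd)
  then show "continuous_on S (directional n (\<lambda>q. (pdy \<psi> q, - pdx \<psi> q)))"
    by (simp only: W cong: continuous_on_cong)
qed

text \<open>Shared core of both cases. The bound \<open>r0\<close> carries the boundary limit over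
  from the momentum to the velocity, and \<open>\<mu>\<close> and \<open>\<Lambda>\<close> are
  supplied by each kind of flow.\<close>

lemma flow_eq_0:
  fixes a b :: plane and v :: "plane \<Rightarrow> plane" and \<psi> \<rho> :: "plane \<Rightarrow> real"
  defines "m \<equiv> \<lambda>q. (pdy \<psi> q, - pdx \<psi> q)" and "n \<equiv> normal a b"
  assumes slope: "snd a \<noteq> snd b"
    and smooth: "smooth_up_to_plate a b \<psi>" and slip: "slip_condition (closed_segment a b) \<psi>"
    and v: "\<And>p. p \<notin> closed_segment a b \<Longrightarrow> v differentiable (at p)"
    and curl: "\<And>p. p \<notin> closed_segment a b \<Longrightarrow> pdx (\<lambda>q. snd (v q)) p - pdy (\<lambda>q. fst (v q)) p = 0"
    and inf: "horizontal_at_infinity v"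
    and mass: "\<And>p. p \<notin> closed_segment a b \<Longrightarrow> \<rho> p *\<^sub>R v p = m p"
    and \<rho>: "0 < r0" "\<And>p. p \<notin> closed_segment a b \<Longrightarrow> r0 \<le> \<rho> p"
    and bnd: "\<And>p. p \<notin> closed_segment a b \<Longrightarrow> norm (v p) \<le> M"
    and U: "continuous_on (- closed_segment a b) (directional n v)"
    and mu: "0 < \<mu>"
    and lower: "\<And>p. p \<notin> closed_segment a b \<Longrightarrow>
      \<mu> * (norm (directional n v p))\<^sup>2 \<le> directional n v p \<bullet> directional n m p"
    and upper: "\<And>p. p \<notin> closed_segment a b \<Longrightarrow> norm (directional n m p) \<le> \<Lambda> * norm (directional n v p)"
    and p: "p \<notin> closed_segment a b"
  shows "v p = 0"
proof -
  let ?B = "closed_segment a b"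
  have op: "open (- ?B)" by (simp add: open_Compl)
  have sm: "smooth_on (- ?B) \<psi>" using smooth by (simp add: smooth_up_to_plate_def)
  note sd = smooth_on_derivatives[OF op sm, simplified Compl_iff]
  define W where "W q = (n \<bullet> (pdx (pdy \<psi>) q, pdy (pdy \<psi>) q), - (n \<bullet> (pdx (pdx \<psi>) q, pdx (pdy \<psi>) q)))" for q
  have W: "directional n m q = W q" if "q \<notin> ?B" for q
    using directional_momentum(1)[OF op sm] that by (simp add: m_def W_def)
  \<comment> \<open>The derivative in direction \<open>n\<close> of the mixed second derivative of
    \<open>\<psi>\<close>.\<close>
  define d where "d q = n \<bullet> (pdx (pdx (pdy \<psi>)) q, pdx (pdy (pdy \<psi>)) q)" for q
  have cont: "continuous_on (- ?B) f" if "\<And>q. q \<notin> ?B \<Longrightarrow> f differentiable (at q)" for f :: "plane \<Rightarrow> real"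
    using that by (auto intro!: continuous_at_imp_continuous_on differentiable_imp_continuous_within)
  have tang0: "n \<bullet> v q = - ((b - a) \<bullet> (pdx \<psi> q, pdy \<psi> q)) / \<rho> q" if "q \<notin> ?B" for q
  proof -
    have "\<rho> q * (n \<bullet> v q) = n \<bullet> m q" unfolding mass[OF that, symmetric] by simp
    then show ?thesis using \<rho>(1) \<rho>(2)[OF that]
      by (simp add: m_def n_def normal_def inner_prod_def field_simps)
  qed
  interpret bounded_flux a b "\<lambda>q. n \<bullet> v q" d "directional n v" W \<mu> \<Lambda> "norm n * M"
  proof
    show "a \<noteq> b" using slope by auto
    show "GDERIV (\<lambda>q. n \<bullet> v q) q :> directional n v q" if "q \<notin> ?B" for q
      by (rule curl_free_gradient[OF v[OF that] curl[OF that]])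
    show "continuous_on (- ?B) W" unfolding W_def[abs_def]
      by (intro continuous_intros cont sd) auto
    show "continuous_on (- ?B) d" unfolding d_def[abs_def]
      by (intro continuous_intros cont sd) auto
    show "((\<lambda>x. fst (W (x, y))) has_real_derivative d (x, y)) (at x)" if "(x, y) \<notin> ?B" for x y
      using GDERIV_pdx[OF differentiable_GDERIV[OF sd(4)[OF that]]] GDERIV_pdx[OF differentiable_GDERIV[OF sd(5)[OF that]]]
      unfolding W_def d_def by (auto simp: inner_prod_def intro!: derivative_eq_intros)
    show "((\<lambda>y. snd (W (x, y))) has_real_derivative - d (x, y)) (at y)" if "(x, y) \<notin> ?B" for x y
      using GDERIV_pdy[OF differentiable_GDERIV[OF sd(3)[OF that]]] GDERIV_pdy[OF differentiable_GDERIV[OF sd(4)[OF that]]]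
        sd(9,10)[OF that]
      unfolding W_def d_def by (auto simp: inner_prod_def intro!: derivative_eq_intros)
    show "\<bar>n \<bullet> v q\<bar> \<le> norm n * M" if "q \<notin> ?B" for q
      using Cauchy_Schwarz_ineq2[of n "v q"] mult_left_mono[OF bnd[OF that] norm_ge_zero[of n]] by linarith
    show "((\<lambda>q. n \<bullet> v q) \<longlongrightarrow> 0) (at q within - ?B)" if q: "q \<in> open_segment a b" for q
    proof (rule Lim_null_comparison)
      let ?g = "\<lambda>q. (b - a) \<bullet> (pdx \<psi> q, pdy \<psi> q)"
      have "norm (n \<bullet> v z) \<le> \<bar>?g z\<bar> / r0" if "z \<notin> ?B" for z
        using tang0[OF that] \<rho>(1) \<rho>(2)[OF that] by (simp add: frac_le)
      then show "eventually (\<lambda>z. norm (n \<bullet> v z) \<le> \<bar>?g z\<bar> / r0) (at q within - ?B)"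
        by (auto simp: eventually_at_filter)
      show "((\<lambda>z. \<bar>?g z\<bar> / r0) \<longlongrightarrow> 0) (at q within - ?B)"
        using tendsto_divide[OF tendsto_rabs[OF tangential_limit[OF smooth slip q]] tendsto_const[of r0]] \<rho>(1)
        by simp
    qed
  qed (use U mu lower upper W in auto)
  show ?thesis
    by (rule tangential_flow_eq_0[OF slope v curl inf _ p]) (use flux_eq_0 n_def in auto)
qed

section \<open>Ellipticity from Bernoulli's law\<close>

text \<open>\<open>W\<close> is the image of \<open>U\<close> under the symmetric matrix
  \<open>r (I - v v^T / c2)\<close>, with eigenvalues \<open>r (1 - |v|^2 / c2)\<close> along
  \<open>v\<close> and \<open>r\<close> across it; \<open>\<kappa>\<close> bounds the squared Mach
  number. The last claim is the Sherman-Morrison inverse.\<close>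

lemma anisotropic_bounds:
  fixes U v W :: plane and r r0 r1 c2 \<kappa> :: real
  assumes W: "W = r *\<^sub>R U - (r * (v \<bullet> U) / c2) *\<^sub>R v"
    and c2: "0 < c2" and v: "(norm v)\<^sup>2 \<le> \<kappa> * c2" and \<kappa>: "\<kappa> < 1"
    and r: "0 < r0" "r0 \<le> r" "r \<le> r1"
  shows "r0 * (1 - \<kappa>) * (norm U)\<^sup>2 \<le> U \<bullet> W"
    and "norm W \<le> r1 * norm U"
    and "U = (1 / r) *\<^sub>R (W + ((v \<bullet> W) / (c2 - (norm v)\<^sup>2)) *\<^sub>R v)"
proof -
  have r': "0 < r" using r by linarith
  have vc: "(norm v)\<^sup>2 < c2"
    using v mult_strict_right_mono[OF \<kappa> c2] by linarith
  have CS: "(v \<bullet> U)\<^sup>2 \<le> (norm v)\<^sup>2 * (norm U)\<^sup>2"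
    using Cauchy_Schwarz_ineq[of v U] by (simp add: power2_norm_eq_inner)
  also have "\<dots> \<le> \<kappa> * c2 * (norm U)\<^sup>2" using v by (intro mult_right_mono) auto
  finally have d: "(v \<bullet> U)\<^sup>2 / c2 \<le> \<kappa> * (norm U)\<^sup>2" using c2 by (simp add: field_simps)
  have UW: "U \<bullet> W = r * ((norm U)\<^sup>2 - (v \<bullet> U)\<^sup>2 / c2)"
    unfolding W by (simp add: inner_diff_right inner_commute dot_square_norm power2_eq_square algebra_simps)
  have "r0 * ((1 - \<kappa>) * (norm U)\<^sup>2) \<le> r * ((1 - \<kappa>) * (norm U)\<^sup>2)"
    using r \<kappa> by (intro mult_right_mono) auto
  also have "\<dots> \<le> U \<bullet> W"
    unfolding UW using d r' by (intro mult_left_mono) (auto simp: algebra_simps)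
  finally show "r0 * (1 - \<kappa>) * (norm U)\<^sup>2 \<le> U \<bullet> W" by (simp add: mult.assoc)
  have "(norm W)\<^sup>2 = r\<^sup>2 * ((norm U)\<^sup>2 - (v \<bullet> U)\<^sup>2 / c2 * (2 - (norm v)\<^sup>2 / c2))"
    using c2 unfolding W power2_norm_eq_inner
    by (simp add: inner_diff_right inner_diff_left inner_commute power2_eq_square field_simps)
  also have "\<dots> \<le> r\<^sup>2 * (norm U)\<^sup>2"
  proof -
    have "(norm v)\<^sup>2 / c2 \<le> 2" using vc c2 by (simp add: field_simps)
    then have "0 \<le> (v \<bullet> U)\<^sup>2 / c2 * (2 - (norm v)\<^sup>2 / c2)" using c2 by simp
    then show ?thesis by (intro mult_left_mono) auto
  qed
  also have "\<dots> = (r * norm U)\<^sup>2" by (simp add: power_mult_distrib)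
  finally have "norm W \<le> r * norm U" using r' by (simp add: power2_le_iff_abs_le)
  also have "\<dots> \<le> r1 * norm U" using r by (intro mult_right_mono) auto
  finally show "norm W \<le> r1 * norm U" .
  have vW: "v \<bullet> W = r * (v \<bullet> U) / c2 * (c2 - (norm v)\<^sup>2)"
    using c2 unfolding W by (simp add: inner_diff_right power2_norm_eq_inner field_simps)
  then have "(v \<bullet> W) / (c2 - (norm v)\<^sup>2) = r * (v \<bullet> U) / c2" using vc by simp
  then show "U = (1 / r) *\<^sub>R (W + ((v \<bullet> W) / (c2 - (norm v)\<^sup>2)) *\<^sub>R v)"
    unfolding W using r' by simp
qed

lemma directional_scaleR:
  fixes v :: "plane \<Rightarrow> plane" and \<rho> :: "plane \<Rightarrow> real"
  assumes v: "v differentiable (at p)" and \<rho>: "GDERIV \<rho> p :> D"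
  shows "directional n (\<lambda>q. \<rho> q *\<^sub>R v q) p = \<rho> p *\<^sub>R directional n v p + (n \<bullet> D) *\<^sub>R v p"
  unfolding directional_def fst_scaleR snd_scaleR real_scaleR_def
    GDERIV_pd[OF GDERIV_mult[OF \<rho> differentiable_components(1)[OF v]], symmetric]
    GDERIV_pd[OF GDERIV_mult[OF \<rho> differentiable_components(2)[OF v]], symmetric]
  by (simp add: inner_prod_def algebra_simps prod_eq_iff)

text \<open>Bernoulli's law can be solved for the density as a power of an expression in
  \<open>v\<close>, so the density is differentiable because \<open>v\<close> is. The denominator is
  the squared sound speed.\<close>

lemma bernoulli_gradient:
  fixes v :: "plane \<Rightarrow> plane" and \<rho> :: "plane \<Rightarrow> real"
  assumes S: "open S" "p \<in> S" and \<gamma>: "1 < \<gamma>" and pos: "\<And>q. q \<in> S \<Longrightarrow> 0 < \<rho> q"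
    and bern: "\<And>q. q \<in> S \<Longrightarrow> (norm (v q))\<^sup>2 / 2 + enthalpy \<gamma> (\<rho> q) = K"
    and v: "v differentiable (at p)"
  shows "\<exists>D. GDERIV \<rho> p :> D \<and> (\<forall>n. n \<bullet> D = - (\<rho> p * (v p \<bullet> directional n v p) / (\<gamma> * \<rho> p powr (\<gamma> - 1))))"
proof -
  define s where "s q = (\<gamma> - 1) / \<gamma> * (K - ((fst (v q))\<^sup>2 + (snd (v q))\<^sup>2) / 2)" for q
  have norm2: "(norm z)\<^sup>2 = (fst z)\<^sup>2 + (snd z)\<^sup>2" for z :: plane
    by (simp add: norm_prod_def)
  have s: "s q = \<rho> q powr (\<gamma> - 1)" if "q \<in> S" for q
  proof -
    have "K - ((fst (v q))\<^sup>2 + (snd (v q))\<^sup>2) / 2 = \<gamma> / (\<gamma> - 1) * \<rho> q powr (\<gamma> - 1)"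
      using bern[OF that] unfolding enthalpy_def norm2 by linarith
    then show ?thesis unfolding s_def using \<gamma> by simp
  qed
  have \<rho>s: "\<rho> q = s q powr (1 / (\<gamma> - 1))" if "q \<in> S" for q
    using s[OF that] pos[OF that] \<gamma> by (simp add: powr_powr)
  have sp: "0 < s p" using s[OF S(2)] pos[OF S(2)] by simp
  let ?x = "(pdx (\<lambda>q. fst (v q)) p, pdy (\<lambda>q. fst (v q)) p)"
  let ?y = "(pdx (\<lambda>q. snd (v q)) p, pdy (\<lambda>q. snd (v q)) p)"
  note X = differentiable_components(1)[OF v] and Y = differentiable_components(2)[OF v]
  define E where "E = (fst (v p)) *\<^sub>R ?x + snd (v p) *\<^sub>R ?y"
  have sD: "GDERIV s p :> - ((\<gamma> - 1) / \<gamma>) *\<^sub>R E"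
  proof -
    have "GDERIV (\<lambda>q. (\<gamma> - 1) / \<gamma> * (K - (fst (v q) * fst (v q) + snd (v q) * snd (v q)) * (1 / 2))) p
        :> ((\<gamma> - 1) / \<gamma>) *\<^sub>R (0 - ((fst (v p) * fst (v p) + snd (v p) * snd (v p)) *\<^sub>R 0
          + (1 / 2) *\<^sub>R ((fst (v p) *\<^sub>R ?x + fst (v p) *\<^sub>R ?x) + (snd (v p) *\<^sub>R ?y + snd (v p) *\<^sub>R ?y))))
          + (K - (fst (v p) * fst (v p) + snd (v p) * snd (v p)) * (1 / 2)) *\<^sub>R 0" (is "GDERIV ?f p :> ?F")
      by (intro GDERIV_mult GDERIV_diff GDERIV_add GDERIV_const X Y)
    moreover have "?f = s"
      by (simp add: s_def fun_eq_iff power2_eq_square)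
    moreover have "(1 / 2) *\<^sub>R ((A + A) + (B + B)) = A + B" for A B :: plane
      by (simp add: prod_eq_iff)
    then have "?F = - ((\<gamma> - 1) / \<gamma>) *\<^sub>R E"
      unfolding E_def by (simp only: scaleR_zero_right add_0_left add_0_right diff_0 scaleR_minus_left scaleR_minus_right)
    ultimately show ?thesis by (simp only:)
  qed
  define D where "D = (1 / (\<gamma> - 1) * s p powr (1 / (\<gamma> - 1) - 1)) *\<^sub>R (- ((\<gamma> - 1) / \<gamma>) *\<^sub>R E)"
  have "GDERIV (\<lambda>q. s q powr (1 / (\<gamma> - 1))) p :> D"
    unfolding D_def by (rule GDERIV_DERIV_compose[OF sD has_real_derivative_powr[OF sp]])
  then have "GDERIV \<rho> p :> D"
    unfolding gderiv_def
    by (rule has_derivative_transform_within_open[OF _ S]) (simp add: \<rho>s)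
  moreover have "n \<bullet> D = - (\<rho> p * (v p \<bullet> directional n v p) / (\<gamma> * \<rho> p powr (\<gamma> - 1)))" for n
  proof -
    have "n \<bullet> E = v p \<bullet> directional n v p"
      by (simp add: E_def directional_def inner_prod_def algebra_simps)
    moreover have "s p powr (1 / (\<gamma> - 1) - 1) = \<rho> p / s p"
      using sp by (simp add: powr_diff \<rho>s[OF S(2), symmetric])
    ultimately have "n \<bullet> D = 1 / (\<gamma> - 1) * (\<rho> p / s p) * (- ((\<gamma> - 1) / \<gamma>) * (v p \<bullet> directional n v p))"
      by (simp add: D_def)
    also have "\<dots> = - (\<rho> p * (v p \<bullet> directional n v p) / (\<gamma> * s p))"
      using \<gamma> by (simp add: mult.commute)
    finally show ?thesis using s[OF S(2)] by simp
  qed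
  ultimately show ?thesis by blast
qed

text \<open>Bernoulli's law splits \<open>K\<close> into nonnegative kinetic and enthalpy parts,
  which bounds \<open>q\<close> and \<open>r\<close> above. The Mach bound makes the kinetic part at
  most a multiple of \<open>r powr (\<gamma> - 1)\<close>, as the enthalpy is, which bounds
  \<open>r\<close> below.\<close>

lemma subsonic_bounds:
  fixes \<gamma> K r q \<delta> :: real
  assumes \<gamma>: "1 < \<gamma>" and K: "0 < K" and r: "0 < r" and q: "0 \<le> q"
    and bern: "q\<^sup>2 / 2 + enthalpy \<gamma> r = K"
    and mach: "q / sound_speed \<gamma> r \<le> 1 - \<delta>"
  shows "q\<^sup>2 \<le> (max 0 (1 - \<delta>))\<^sup>2 * (\<gamma> * r powr (\<gamma> - 1))"
    and "0 < \<delta> \<Longrightarrow> (K / (\<gamma> / (\<gamma> - 1) + \<gamma> / 2)) powr (1 / (\<gamma> - 1)) \<le> r"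
    and "r \<le> ((\<gamma> - 1) / \<gamma> * K) powr (1 / (\<gamma> - 1))"
    and "q \<le> sqrt (2 * K)"
proof -
  let ?s = "r powr (\<gamma> - 1)"
  have s: "0 < ?s" using r by simp
  have rs: "r = ?s powr (1 / (\<gamma> - 1))" using \<gamma> r by (simp add: powr_powr)
  have c: "(sound_speed \<gamma> r)\<^sup>2 = \<gamma> * ?s" "0 < sound_speed \<gamma> r"
    using \<gamma> s by (simp_all add: sound_speed_def)
  have "q \<le> max 0 (1 - \<delta>) * sound_speed \<gamma> r"
  proof -
    have "q \<le> (1 - \<delta>) * sound_speed \<gamma> r" using mach c by (simp add: field_simps)
    also have "\<dots> \<le> max 0 (1 - \<delta>) * sound_speed \<gamma> r" using c by (intro mult_right_mono) auto
    finally show ?thesis .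
  qed
  then have "q\<^sup>2 \<le> (max 0 (1 - \<delta>) * sound_speed \<gamma> r)\<^sup>2" using q by (rule power_mono)
  then show q2: "q\<^sup>2 \<le> (max 0 (1 - \<delta>))\<^sup>2 * (\<gamma> * ?s)" by (simp add: power_mult_distrib c)
  have e: "q\<^sup>2 / 2 + \<gamma> / (\<gamma> - 1) * ?s = K" using bern by (simp add: enthalpy_def)
  have e0: "0 \<le> \<gamma> / (\<gamma> - 1) * ?s" using \<gamma> s by simp
  show "q \<le> sqrt (2 * K)" using e e0 by (intro real_le_rsqrt) linarith
  have "\<gamma> / (\<gamma> - 1) * ?s \<le> K" using e zero_le_power2[of q] by linarith
  then have "(\<gamma> - 1) / \<gamma> * (\<gamma> / (\<gamma> - 1) * ?s) \<le> (\<gamma> - 1) / \<gamma> * K"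
    using \<gamma> by (intro mult_left_mono) auto
  then have "?s \<le> (\<gamma> - 1) / \<gamma> * K" using \<gamma> by simp
  then have "?s powr (1 / (\<gamma> - 1)) \<le> ((\<gamma> - 1) / \<gamma> * K) powr (1 / (\<gamma> - 1))"
    using \<gamma> s by (intro powr_mono2) auto
  then show "r \<le> ((\<gamma> - 1) / \<gamma> * K) powr (1 / (\<gamma> - 1))" using rs by simp
  show "(K / (\<gamma> / (\<gamma> - 1) + \<gamma> / 2)) powr (1 / (\<gamma> - 1)) \<le> r" if \<delta>: "0 < \<delta>"
  proof -
    have "0 \<le> 1 - \<delta>" using mach q c by (meson divide_nonneg_pos order_trans)
    then have "(max 0 (1 - \<delta>))\<^sup>2 \<le> 1" using \<delta> by (simp add: abs_square_le_1)
    then have "(max 0 (1 - \<delta>))\<^sup>2 * (\<gamma> * ?s) \<le> 1 * (\<gamma> * ?s)" using \<gamma> s by (intro mult_right_mono) auto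
    then have "q\<^sup>2 \<le> \<gamma> * ?s" using q2 by linarith
    then have "K \<le> (\<gamma> / (\<gamma> - 1) + \<gamma> / 2) * ?s" using e by (simp add: algebra_simps)
    moreover have pos: "0 < \<gamma> / (\<gamma> - 1) + \<gamma> / 2" using \<gamma> by (intro add_pos_pos) auto
    ultimately have "K / (\<gamma> / (\<gamma> - 1) + \<gamma> / 2) \<le> ?s" by (simp add: pos_divide_le_eq mult.commute)
    then have "(K / (\<gamma> / (\<gamma> - 1) + \<gamma> / 2)) powr (1 / (\<gamma> - 1)) \<le> ?s powr (1 / (\<gamma> - 1))"
      using \<gamma> K pos by (intro powr_mono2) auto
    then show ?thesis using rs by simp
  qed
qed

lemma subsonic_flow_trivial:
  fixes a b :: plane
  assumes \<gamma>: "1 < \<gamma>" and K: "0 < K" and ab: "snd a \<noteq> snd b"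
    and flow: "uniformly_subsonic_flow \<gamma> K a b \<psi> v \<rho>" and p: "p \<notin> closed_segment a b"
  shows "v p = 0"
proof -
  let ?B = "closed_segment a b" and ?n = "normal a b" and ?m = "\<lambda>q. (pdy \<psi> q, - pdx \<psi> q)"
  from flow have smooth: "smooth_up_to_plate a b \<psi>" and slip: "slip_condition ?B \<psi>"
    and inf: "horizontal_at_infinity v"
    and pos: "\<And>q. q \<notin> ?B \<Longrightarrow> 0 < \<rho> q"
    and mass: "\<And>q. q \<notin> ?B \<Longrightarrow> \<rho> q *\<^sub>R v q = ?m q"
    and bern: "\<And>q. q \<notin> ?B \<Longrightarrow> (norm (v q))\<^sup>2 / 2 + enthalpy \<gamma> (\<rho> q) = K"
    and v: "\<And>q. q \<notin> ?B \<Longrightarrow> v differentiable (at q)"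
    and curl: "\<And>q. q \<notin> ?B \<Longrightarrow> pdx (\<lambda>q. snd (v q)) q - pdy (\<lambda>q. fst (v q)) q = 0"
    and mach': "\<exists>\<delta>>0. \<forall>q\<in>- ?B. norm (v q) / sound_speed \<gamma> (\<rho> q) \<le> 1 - \<delta>"
    by (simp_all add: uniformly_subsonic_flow_def Let_def)
  from mach' obtain \<delta> where \<delta>: "0 < \<delta>"
    and mach: "\<And>q. q \<notin> ?B \<Longrightarrow> norm (v q) / sound_speed \<gamma> (\<rho> q) \<le> 1 - \<delta>" by auto
  \<comment> \<open>The maximum keeps \<open>\<kappa> < 1\<close> even for \<open>\<delta>\<close>
    at least 2, where the square of \<open>1 - \<delta>\<close> is at least 1.\<close>
  define \<kappa> where "\<kappa> = (max 0 (1 - \<delta>))\<^sup>2"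
  define r0 where "r0 = (K / (\<gamma> / (\<gamma> - 1) + \<gamma> / 2)) powr (1 / (\<gamma> - 1))"
  define r1 where "r1 = ((\<gamma> - 1) / \<gamma> * K) powr (1 / (\<gamma> - 1))"
  define c2 where "c2 q = \<gamma> * \<rho> q powr (\<gamma> - 1)" for q
  note sb = subsonic_bounds[OF \<gamma> K pos norm_ge_zero bern mach]
  have v2: "(norm (v q))\<^sup>2 \<le> \<kappa> * c2 q" if "q \<notin> ?B" for q
    using sb(1)[OF that that that] by (simp add: \<kappa>_def c2_def)
  have \<rho>01: "r0 \<le> \<rho> q" "\<rho> q \<le> r1" if "q \<notin> ?B" for q
    using sb(2)[OF that that that \<delta>] sb(3)[OF that that that] by (simp_all add: r0_def r1_def)
  have bnd: "norm (v q) \<le> sqrt (2 * K)" if "q \<notin> ?B" for q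
    using sb(4)[OF that that that] .
  have "0 < \<gamma> / (\<gamma> - 1) + \<gamma> / 2" using \<gamma> by (intro add_pos_pos) auto
  then have r0: "0 < r0" using K by (simp add: r0_def)
  have \<kappa>: "\<kappa> < 1" using \<delta> by (auto simp: \<kappa>_def max_def abs_square_less_1 power_less_one_iff)
  have c2: "0 < c2 q" if "q \<notin> ?B" for q using pos[OF that] \<gamma> by (simp add: c2_def)
  have op: "open (- ?B)" by (simp add: open_Compl)
  have W: "directional ?n ?m q
      = \<rho> q *\<^sub>R directional ?n v q - (\<rho> q * (v q \<bullet> directional ?n v q) / c2 q) *\<^sub>R v q" (is ?W)
    and \<rho>d: "\<exists>D. GDERIV \<rho> q :> D" (is ?D) if q: "q \<notin> ?B" for q
  proof -
    from bernoulli_gradient[of "- ?B" q \<gamma> \<rho> v K] op q \<gamma> pos bern v obtain D where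
      D: "GDERIV \<rho> q :> D" "\<And>n. n \<bullet> D = - (\<rho> q * (v q \<bullet> directional n v q) / (\<gamma> * \<rho> q powr (\<gamma> - 1)))"
      by auto
    have "directional ?n ?m q = directional ?n (\<lambda>q. \<rho> q *\<^sub>R v q) q"
      using q by (intro directional_cong_open[OF op]) (auto simp: mass)
    then show ?W unfolding directional_scaleR[OF v[OF q] D(1)] D(2) c2_def by simp
    show ?D using D by blast
  qed
  note ab' = anisotropic_bounds[OF W c2 v2 \<kappa> r0 \<rho>01]
  show ?thesis
  proof (rule flow_eq_0[OF ab smooth slip v curl inf mass r0 \<rho>01(1) bnd])
    have vc: "continuous_on (- ?B) v"
      using v by (auto intro!: continuous_at_imp_continuous_on differentiable_imp_continuous_within)
    have \<rho>c: "continuous_on (- ?B) \<rho>"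
      using \<rho>d by (auto intro!: continuous_at_imp_continuous_on dest!: has_derivative_continuous simp: gderiv_def)
    have "smooth_on (- ?B) \<psi>" using smooth by (simp add: smooth_up_to_plate_def)
    note Wc = directional_momentum(2)[OF op this, of ?n]
    have ne: "c2 q - (norm (v q))\<^sup>2 \<noteq> 0" "\<rho> q \<noteq> 0" if "q \<notin> ?B" for q
      using v2[OF that] mult_strict_right_mono[OF \<kappa> c2[OF that]] pos[OF that] by auto
    \<comment> \<open>The inverse formula writes \<open>directional ?n v\<close> through the
      continuous flux; the subsonic bound keeps the denominator from vanishing.\<close>
    have "continuous_on (- ?B) (\<lambda>q. (1 / \<rho> q) *\<^sub>R (directional ?n ?m q
        + ((v q \<bullet> directional ?n ?m q) / (c2 q - (norm (v q))\<^sup>2)) *\<^sub>R v q))"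
      using ne unfolding c2_def
      by (intro continuous_intros vc \<rho>c Wc) (auto simp: c2_def)
    then show "continuous_on (- ?B) (directional ?n v)"
      by (rule continuous_on_cong[THEN iffD1, rotated 2]) (use ab'(3) in auto)
    show "0 < r0 * (1 - \<kappa>)" using r0 \<kappa> by simp
  qed (use ab' p in auto)
qed

text \<open>With density 1 the flux is the gradient of \<open>u\<close> itself, so both ellipticity
  constants are 1. The curl of \<open>v\<close> is minus the Laplacian of
  \<open>\<psi>\<close>.\<close>

lemma incompressible_flow_trivial:
  fixes a b :: plane
  assumes ab: "snd a \<noteq> snd b"
    and flow: "incompressible_flow a b \<psi> v" and bnd: "bounded (v ` (- closed_segment a b))"
    and p: "p \<notin> closed_segment a b"
  shows "v p = 0"
proof -
  let ?B = "closed_segment a b" and ?n = "normal a b" and ?m = "\<lambda>q. (pdy \<psi> q, - pdx \<psi> q)"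
  from flow have smooth: "smooth_up_to_plate a b \<psi>" and slip: "slip_condition ?B \<psi>"
    and inf: "horizontal_at_infinity v" and sm: "smooth_on (- ?B) \<psi>"
    and lap: "\<And>q. q \<notin> ?B \<Longrightarrow> laplacian \<psi> q = 0"
    and vm: "\<And>q. q \<notin> ?B \<Longrightarrow> v q = ?m q"
    by (simp_all add: incompressible_flow_def harmonic_on_def Let_def)
  have op: "open (- ?B)" by (simp add: open_Compl)
  note sd = smooth_on_derivatives[OF op sm, simplified Compl_iff]
  from bnd obtain M where M: "\<And>q. q \<notin> ?B \<Longrightarrow> norm (v q) \<le> M" by (auto simp: bounded_iff)
  have D: "directional ?n ?m q = directional ?n v q" if "q \<notin> ?B" for q
    using that vm by (intro directional_cong_open[OF op]) auto
  have v: "v differentiable (at q)" if "q \<notin> ?B" for q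
  proof (rule differentiable_cong_open[OF op _ vm])
    show "?m differentiable (at q)"
    proof -
      from sd(1,2)[OF that] obtain D D' where "(pdx \<psi> has_derivative D) (at q)" "(pdy \<psi> has_derivative D') (at q)"
        by (auto simp: differentiable_def)
      from has_derivative_Pair[OF this(2) has_derivative_minus[OF this(1)]]
      show ?thesis unfolding differentiable_def by blast
    qed
  qed (use that in auto)
  have curl: "pdx (\<lambda>q. snd (v q)) q - pdy (\<lambda>q. fst (v q)) q = 0" if "q \<notin> ?B" for q
    using that lap[OF that] pd_cong_open[OF op, of q "\<lambda>q. snd (v q)" "\<lambda>q. - pdx \<psi> q"]
      pd_cong_open[OF op, of q "\<lambda>q. fst (v q)" "pdy \<psi>"] vm sd(1)[OF that]
    by (simp add: pd_uminus laplacian_def)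
  show ?thesis
  proof (rule flow_eq_0[OF ab smooth slip v curl inf, where \<rho>="\<lambda>_. 1" and ?r0.0=1 and \<mu>=1 and \<Lambda>=1])
    show "continuous_on (- ?B) (directional ?n v)"
      by (rule continuous_on_cong[THEN iffD1, OF refl D directional_momentum(2)[OF op sm]]) simp
  qed (use vm M D p in \<open>auto simp: power2_norm_eq_inner\<close>)
qed

theorem theorem3:
  fixes a b :: "real \<times> real" and \<gamma> K :: real
  assumes "\<gamma> > 1" and "K > 0"
    and "a \<noteq> b" and "snd a \<noteq> snd b"
  shows "(\<nexists>\<psi> v \<rho>. uniformly_subsonic_flow \<gamma> K a b \<psi> v \<rho> \<and> nontrivial_flow a b v) \<and>
    (\<nexists>\<psi> v. incompressible_flow a b \<psi> v \<and> bounded (v ` (- closed_segment a b)) \<and>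
            nontrivial_flow a b v)"
  using assms subsonic_flow_trivial incompressible_flow_trivial
  unfolding nontrivial_flow_def by blast

end
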